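(* Let $k\geq 3$, let $n$ be a positive odd integer, and let $G_1=P_1\times\cdots\times P_m$ ($m\geq 1$) be a finite nilpotent group of odd order whose Sylow subgroups $P_1,\dots,P_m$ (for the distinct prime divisors $p_1,\dots,p_m$ of $|G_1|$) are not cyclic. Let $r_i$ be the number of distinct subgroups of order $p_i$ in $P_i$, indexed so that $r_1\leq r_2\leq\cdots\leq r_m$. (a) If $G=Q_{2^k}$ or $G=\mathbb{Z}_n\times Q_{2^k}$, then $\gamma(\mathcal{G}_E^{**}(G))=2^{k-2}+1$. (b) If $G=G_1\times Q_{2^k}$, or $G=G_1\times\mathbb{Z}_n\times Q_{2^k}$ with $\gcd(|G_1|,n)=1$, then $\gamma(\mathcal{G}_E^{**}(G))=\min\{r_1,\,2^{k-2}+1\}$.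
   Context: $\mathbb{Z}_n$ denotes the cyclic group of order $n$. The generalized quaternion group $Q_{2^k}$ ($k\geq 3$) is the group of order $2^k$ generated by $x,y$ with $x^{2^{k-1}}=1$, $x^{2^{k-2}}=y^2$ and $yxy^{-1}=x^{-1}$. The enhanced power graph $\mathcal{G}_E(G)$ of a group $G$ is the simple graph with vertex set $G$ in which two distinct vertices $u,v$ are adjacent if and only if there is $w\in G$ with $u\in\langle w\rangle$ and $v\in\langle w\rangle$. A dominating vertex of a graph is a vertex adjacent to every other vertex. The proper enhanced power graph $\mathcal{G}_E^{**}(G)$ is the graph obtained from $\mathcal{G}_E(G)$ by deleting all of its dominating vertices (including the identity). A dominating set of a graph $\Gamma=(V,E)$ is a set $D\subseteq V$ such that every vertex of $V\setminus D$ is adjacent to some vertex of $D$. The domination number $\gamma(\Gamma)$ is the minimum cardinality of a dominating set of $\Gamma$. *)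

theory Defs
  imports "HOL-Algebra.Algebra"
begin

text \<open>A simple graph is a pair \<open>(V, E)\<close> of a vertex set and a set of two-element subsets of \<open>V\<close>;
  \<open>u\<close> and \<open>v\<close> are adjacent iff \<open>{u, v} \<in> E\<close>.\<close>

type_synonym 'v sgraph = "'v set \<times> 'v set set"

abbreviation vertices :: "'v sgraph \<Rightarrow> 'v set" where "vertices \<equiv> fst"
abbreviation edges :: "'v sgraph \<Rightarrow> 'v set set" where "edges \<equiv> snd"

definition dominating_vertex :: "'v sgraph \<Rightarrow> 'v \<Rightarrow> bool" where
  "dominating_vertex \<Gamma> v \<longleftrightarrow>
     v \<in> vertices \<Gamma> \<and> (\<forall>u \<in> vertices \<Gamma> - {v}. {u, v} \<in> edges \<Gamma>)"

definition delete_vertices :: "'v sgraph \<Rightarrow> 'v set \<Rightarrow> 'v sgraph" where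
  "delete_vertices \<Gamma> S = (vertices \<Gamma> - S, {e \<in> edges \<Gamma>. e \<inter> S = {}})"

definition dominating_set :: "'v sgraph \<Rightarrow> 'v set \<Rightarrow> bool" where
  "dominating_set \<Gamma> D \<longleftrightarrow>
     D \<subseteq> vertices \<Gamma> \<and> (\<forall>v \<in> vertices \<Gamma> - D. \<exists>u \<in> D. {u, v} \<in> edges \<Gamma>)"

text \<open>Finiteness of \<open>D\<close> is required because \<open>card\<close> is \<open>0\<close> on infinite sets.\<close>

definition domination_number :: "'v sgraph \<Rightarrow> nat" where
  "domination_number \<Gamma> = (LEAST d. \<exists>D. dominating_set \<Gamma> D \<and> finite D \<and> card D = d)"

definition enhanced_power_graph :: "('a, 'b) monoid_scheme \<Rightarrow> 'a sgraph" where
  "enhanced_power_graph G =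
     (carrier G,
      {{u, v} | u v. u \<in> carrier G \<and> v \<in> carrier G \<and> u \<noteq> v \<and>
         (\<exists>w \<in> carrier G. u \<in> generate G {w} \<and> v \<in> generate G {w})})"

definition proper_enhanced_power_graph :: "('a, 'b) monoid_scheme \<Rightarrow> 'a sgraph" where
  "proper_enhanced_power_graph G =
     delete_vertices (enhanced_power_graph G)
       {v. dominating_vertex (enhanced_power_graph G) v}"

text \<open>Meant for \<open>k \<ge> 3\<close>, where the order together with the relations determines the group up to
  isomorphism.\<close>

definition generalized_quaternion :: "nat \<Rightarrow> ('a, 'b) monoid_scheme \<Rightarrow> bool" where
  "generalized_quaternion k Q \<longleftrightarrow>
     group Q \<and> order Q = 2 ^ k \<and>
     (\<exists>x \<in> carrier Q. \<exists>y \<in> carrier Q.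
        generate Q {x, y} = carrier Q \<and>
        x [^]\<^bsub>Q\<^esub> (2 ^ (k - 1) :: nat) = \<one>\<^bsub>Q\<^esub> \<and>
        x [^]\<^bsub>Q\<^esub> (2 ^ (k - 2) :: nat) = y [^]\<^bsub>Q\<^esub> (2 :: nat) \<and>
        y \<otimes>\<^bsub>Q\<^esub> x \<otimes>\<^bsub>Q\<^esub> inv\<^bsub>Q\<^esub> y = inv\<^bsub>Q\<^esub> x)"

definition commutator_subgroup :: "('a, 'b) monoid_scheme \<Rightarrow> 'a set \<Rightarrow> 'a set \<Rightarrow> 'a set" where
  "commutator_subgroup G H K =
     generate G {h \<otimes>\<^bsub>G\<^esub> k \<otimes>\<^bsub>G\<^esub> inv\<^bsub>G\<^esub> h \<otimes>\<^bsub>G\<^esub> inv\<^bsub>G\<^esub> k | h k. h \<in> H \<and> k \<in> K}"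

primrec lower_central_series :: "('a, 'b) monoid_scheme \<Rightarrow> nat \<Rightarrow> 'a set" where
  "lower_central_series G 0 = carrier G"
| "lower_central_series G (Suc i) = commutator_subgroup G (lower_central_series G i) (carrier G)"

definition nilpotent_group :: "('a, 'b) monoid_scheme \<Rightarrow> bool" where
  "nilpotent_group G \<longleftrightarrow> group G \<and> (\<exists>c. lower_central_series G c = {\<one>\<^bsub>G\<^esub>})"

definition sylow_subgroup :: "('a, 'b) monoid_scheme \<Rightarrow> nat \<Rightarrow> 'a set \<Rightarrow> bool" where
  "sylow_subgroup G p H \<longleftrightarrow>
     Factorial_Ring.prime p \<and> subgroup H G \<and> card H = p ^ multiplicity p (order G)"

definition num_subgroups :: "('a, 'b) monoid_scheme \<Rightarrow> nat \<Rightarrow> nat" where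
  "num_subgroups G d = card {H. subgroup H G \<and> card H = d}"

end

theory Submission
  imports Defs "HOL-Number_Theory.Residues"
begin

text \<open>By the Chinese remainder theorem, two elements of a product of finite groups of coprime orders
  lie in a common cyclic subgroup iff their components do. Hence dominating vertices are the tuples of
  dominating vertices, and the domination number of the proper enhanced power graph of such a product
  is the minimum over the noncyclic factors: a dominating set of one factor dominates the product, while
  a smaller set misses a vertex in each factor, and the tuple of these is not dominated. In a noncyclic
  \<open>p\<close>-group with \<open>p\<close> odd only the identity is dominating, because a noncyclic group has two subgroups of
  order \<open>p\<close>. Adjacent vertices have the same subgroup of order \<open>p\<close> below them, and a generator of that
  subgroup is adjacent to all of them, so the domination number is the number of these subgroups. In \<open>Q\<close> the dominating vertices are \<open>1\<close> and the involution \<open>z\<close>, and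
  on the remaining vertices adjacency is an equivalence relation with classes \<open>\<langle>x\<rangle> - {1, z}\<close> and the
  \<open>2\<^bsup>k-2\<^esup>\<close> pairs \<open>{u, zu}\<close> outside \<open>\<langle>x\<rangle>\<close>.\<close>

section \<open>Domination numbers of reflexive relations\<close>

text \<open>Relations are kept reflexive instead of working with edges. In a product, adjacent
  vertices may agree in one component, so only the reflexive form of adjacency is
  componentwise.\<close>

definition universal_points :: "'v set \<Rightarrow> ('v \<Rightarrow> 'v \<Rightarrow> bool) \<Rightarrow> 'v set" where
  "universal_points V R = {v \<in> V. \<forall>u \<in> V. R v u}"

text \<open>The domination number of \<open>R\<close> on the non-universal points. It is required to be positive because
  a factor without non-universal points drops out of the minimum in \<open>has_dom_number_prod\<close>.\<close>

definition has_dom_number :: "'v set \<Rightarrow> ('v \<Rightarrow> 'v \<Rightarrow> bool) \<Rightarrow> nat \<Rightarrow> bool" where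
  "has_dom_number V R r \<longleftrightarrow> r > 0 \<and>
     (\<exists>T \<subseteq> V - universal_points V R. finite T \<and> card T = r \<and>
        (\<forall>v \<in> V - universal_points V R. \<exists>t \<in> T. R t v)) \<and>
     (\<forall>D \<subseteq> V - universal_points V R. finite D \<and> card D < r \<longrightarrow>
        (\<exists>v \<in> V - universal_points V R. \<forall>d \<in> D. \<not> R d v))"

lemma has_dom_number_undominated:
  assumes "has_dom_number V R r" "D \<subseteq> V - universal_points V R" "finite D" "card D < r"
  obtains v where "v \<in> V - universal_points V R" "\<And>d. d \<in> D \<Longrightarrow> \<not> R d v"
  using assms unfolding has_dom_number_def by meson

lemma universal_points_bij:
  assumes f: "bij_betw f V W"
    and R: "\<And>u v. u \<in> V \<Longrightarrow> v \<in> V \<Longrightarrow> S (f u) (f v) \<longleftrightarrow> R u v"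
  shows "universal_points W S = f ` universal_points V R"
proof -
  have W: "W = f ` V" using f by (simp add: bij_betw_def)
  show ?thesis unfolding universal_points_def W using R by auto
qed

text \<open>Both bounds transport along \<open>f\<close>: dominating sets are pushed forward, small
  sets are pulled back. With \<open>f = id\<close> this replaces a relation by one that agrees with
  it on \<open>V\<close>.\<close>

lemma has_dom_number_bij:
  assumes f: "bij_betw f V W"
    and R: "\<And>u v. u \<in> V \<Longrightarrow> v \<in> V \<Longrightarrow> S (f u) (f v) \<longleftrightarrow> R u v"
    and r: "has_dom_number V R r"
  shows "has_dom_number W S r"
proof -
  define A where "A = V - universal_points V R"
  define B where "B = W - universal_points W S"
  have inj: "inj_on f V" using f by (simp add: bij_betw_def)
  have AV: "A \<subseteq> V" by (auto simp: A_def)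
  have B: "B = f ` A"
  proof -
    have "universal_points W S = f ` universal_points V R"
      using f R by (rule universal_points_bij)
    moreover have "W = f ` V" using f by (simp add: bij_betw_def)
    moreover have "f ` (V - universal_points V R) = f ` V - f ` universal_points V R"
      by (rule inj_on_image_set_diff[OF inj]) (auto simp: universal_points_def)
    ultimately show ?thesis unfolding A_def B_def by simp
  qed
  from r obtain T where T: "T \<subseteq> A" "finite T" "card T = r" "\<forall>v\<in>A. \<exists>t\<in>T. R t v"
    unfolding has_dom_number_def A_def by blast
  have "f ` T \<subseteq> B" using T B by auto
  moreover have "card (f ` T) = r"
    using T inj AV by (metis card_image inj_on_subset subset_trans)
  moreover have "\<forall>v\<in>B. \<exists>t\<in>f ` T. S t v" using T R AV unfolding B by fastforce
  ultimately have up: "\<exists>T\<subseteq>B. finite T \<and> card T = r \<and> (\<forall>v\<in>B. \<exists>t\<in>T. S t v)"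
    using T by blast
  have "\<exists>v\<in>B. \<forall>d\<in>D. \<not> S d v" if D: "D \<subseteq> B" "finite D" "card D < r" for D
  proof -
    obtain E where E: "E \<subseteq> A" "D = f ` E" using D(1) B by (meson subset_image_iff)
    have "inj_on f E" using E AV inj by (meson inj_on_subset subset_trans)
    then have "finite E" "card E < r" using D E by (auto simp: card_image finite_image_iff)
    then obtain v where "v \<in> A" "\<forall>d\<in>E. \<not> R d v"
      using r E unfolding has_dom_number_def A_def by blast
    moreover have "\<not> S (f d) (f v)" if "d \<in> E" for d
      using that R[of d v] E(1) AV calculation by blast
    ultimately show ?thesis unfolding B E(2) by blast
  qed
  then show ?thesis using up r unfolding has_dom_number_def B_def by simp
qed

section \<open>Domination in products of relations\<close>

lemma universal_points_prod:
  assumes "V \<noteq> {}" "W \<noteq> {}"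
  shows "universal_points (V \<times> W) (\<lambda>a b. R (fst a) (fst b) \<and> S (snd a) (snd b))
       = universal_points V R \<times> universal_points W S"
  using assms unfolding universal_points_def by fastforce

text \<open>A dominating set of one factor, paired with a universal point of the other, dominates
  the product, which gives the upper bound. For the lower bound, the projections of a small set are
  each too small to dominate their factor.\<close>

lemma has_dom_number_prod:
  fixes V :: "'a set" and W :: "'b set"
  assumes V: "has_dom_number V R a" and W: "has_dom_number W S b"
    and symR: "\<And>u v. R u v \<Longrightarrow> R v u" and symS: "\<And>u v. S u v \<Longrightarrow> S v u"
    and uR: "e \<in> universal_points V R" and uS: "e' \<in> universal_points W S"
  shows "has_dom_number (V \<times> W) (\<lambda>a b. R (fst a) (fst b) \<and> S (snd a) (snd b)) (min a b)"
    (is "has_dom_number _ ?P _")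
proof -
  have U: "universal_points (V \<times> W) ?P = universal_points V R \<times> universal_points W S"
    using uR uS by (intro universal_points_prod) (auto simp: universal_points_def)
  let ?X = "V \<times> W - universal_points (V \<times> W) ?P"
  from V obtain T where T: "T \<subseteq> V - universal_points V R" "finite T" "card T = a"
      "\<forall>v\<in>V - universal_points V R. \<exists>t\<in>T. R t v" and a: "a > 0"
    unfolding has_dom_number_def by blast
  from W obtain T' where T': "T' \<subseteq> W - universal_points W S" "finite T'" "card T' = b"
      "\<forall>v\<in>W - universal_points W S. \<exists>t\<in>T'. S t v" and b: "b > 0"
    unfolding has_dom_number_def by blast
  \<comment> \<open>A non-universal pair may have a universal component, which \<open>T\<close> is
    not assumed to dominate. Any element of \<open>T\<close> is related to such a component, and
    \<open>a > 0\<close> provides one.\<close>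
  have dR: "\<exists>t\<in>T. R t v" if "v \<in> V" for v
  proof (cases "v \<in> universal_points V R")
    case True
    moreover obtain t where "t \<in> T" using T(3) a by (metis card.empty ex_in_conv less_irrefl)
    ultimately show ?thesis using T(1) symR unfolding universal_points_def by blast
  qed (use T that in blast)
  have dS: "\<exists>t\<in>T'. S t v" if "v \<in> W" for v
  proof (cases "v \<in> universal_points W S")
    case True
    moreover obtain t where "t \<in> T'" using T'(3) b by (metis card.empty ex_in_conv less_irrefl)
    ultimately show ?thesis using T'(1) symS unfolding universal_points_def by blast
  qed (use T' that in blast)
  have up: "\<exists>T\<subseteq>?X. finite T \<and> card T = min a b \<and> (\<forall>v\<in>?X. \<exists>t\<in>T. ?P t v)"
  proof (cases "a \<le> b")
    case True
    have "T \<times> {e'} \<subseteq> ?X" unfolding U using T(1) uS by (auto simp: universal_points_def)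
    moreover have "card (T \<times> {e'}) = min a b" "finite (T \<times> {e'})"
      using T True by (auto simp: card_cartesian_product)
    moreover have "\<forall>v\<in>?X. \<exists>t\<in>T \<times> {e'}. ?P t v"
      using dR uS unfolding universal_points_def by fastforce
    ultimately show ?thesis by blast
  next
    case False
    have "{e} \<times> T' \<subseteq> ?X" unfolding U using T'(1) uR by (auto simp: universal_points_def)
    moreover have "card ({e} \<times> T') = min a b" "finite ({e} \<times> T')"
      using T' False by (auto simp: card_cartesian_product)
    moreover have "\<forall>v\<in>?X. \<exists>t\<in>{e} \<times> T'. ?P t v"
      using dS uR unfolding universal_points_def by fastforce
    ultimately show ?thesis by blast
  qed
  have "\<exists>v\<in>?X. \<forall>d\<in>D. \<not> ?P d v" if D: "D \<subseteq> ?X" "finite D" "card D < min a b" for D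
  proof -
    \<comment> \<open>Universal components are dropped because the factor bounds speak only of
      non-universal points. Each element of \<open>D\<close> keeps at least one component, and that
      one already fails to dominate its coordinate of \<open>(v, w)\<close>.\<close>
    let ?D1 = "fst ` D - universal_points V R" and ?D2 = "snd ` D - universal_points W S"
    have fin: "finite ?D1" "finite ?D2" using D(2) by auto
    have "card ?D1 \<le> card (fst ` D)" "card ?D2 \<le> card (snd ` D)"
      using D(2) by (auto intro: card_mono)
    moreover have "card (fst ` D) \<le> card D" "card (snd ` D) \<le> card D"
      using D(2) by (auto intro: card_image_le)
    ultimately have c: "card ?D1 < a" "card ?D2 < b" using D(3) by linarith+
    have s: "?D1 \<subseteq> V - universal_points V R" "?D2 \<subseteq> W - universal_points W S"
      using D(1) by auto
    obtain v where v: "v \<in> V - universal_points V R" "\<And>d. d \<in> ?D1 \<Longrightarrow> \<not> R d v"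
      using has_dom_number_undominated[OF V s(1) fin(1) c(1)] by metis
    obtain w where w: "w \<in> W - universal_points W S" "\<And>d. d \<in> ?D2 \<Longrightarrow> \<not> S d w"
      using has_dom_number_undominated[OF W s(2) fin(2) c(2)] by metis
    note vw = v w
    have "\<not> ?P d (v, w)" if "d \<in> D" for d
      using that D(1) vw unfolding U by (cases d) force
    moreover have "(v, w) \<in> ?X" unfolding U using vw by auto
    ultimately show ?thesis by blast
  qed
  then show ?thesis using up a b unfolding has_dom_number_def by simp
qed

text \<open>A factor in which all points are related contributes nothing, so domination is decided
  in the second component. This will be the case of a cyclic factor.\<close>

lemma has_dom_number_prod_total:
  assumes W: "has_dom_number W S b" and ne: "e \<in> V" and R: "\<And>u v. u \<in> V \<Longrightarrow> v \<in> V \<Longrightarrow> R u v"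
  shows "has_dom_number (V \<times> W) (\<lambda>a b. R (fst a) (fst b) \<and> S (snd a) (snd b)) b"
    (is "has_dom_number _ ?P _")
proof -
  from W obtain T where T: "T \<subseteq> W - universal_points W S" "finite T" "card T = b"
      "\<forall>v\<in>W - universal_points W S. \<exists>t\<in>T. S t v" and b: "b > 0"
    unfolding has_dom_number_def by blast
  have "W \<noteq> {}" using T b by fastforce
  then have U: "universal_points (V \<times> W) ?P = V \<times> universal_points W S"
    using ne R by (subst universal_points_prod) (auto simp: universal_points_def)
  let ?X = "V \<times> W - universal_points (V \<times> W) ?P"
  have "{e} \<times> T \<subseteq> ?X" "finite ({e} \<times> T)" "card ({e} \<times> T) = b"
    unfolding U using T ne by (auto simp: card_cartesian_product)
  moreover have "\<forall>v\<in>?X. \<exists>t\<in>{e} \<times> T. ?P t v"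
    unfolding U using T(4) ne R by fastforce
  ultimately have up: "\<exists>T\<subseteq>?X. finite T \<and> card T = b \<and> (\<forall>v\<in>?X. \<exists>t\<in>T. ?P t v)" by blast
  have "\<exists>v\<in>?X. \<forall>d\<in>D. \<not> ?P d v" if D: "D \<subseteq> ?X" "finite D" "card D < b" for D
  proof -
    have "card (snd ` D) < b" using D by (meson card_image_le le_less_trans)
    moreover have "snd ` D \<subseteq> W - universal_points W S" using D(1) unfolding U by auto
    ultimately obtain w where "w \<in> W - universal_points W S" "\<And>d. d \<in> snd ` D \<Longrightarrow> \<not> S d w"
      using W D(2) by (metis has_dom_number_undominated finite_imageI)
    then have "(e, w) \<in> ?X" "\<forall>d\<in>D. \<not> ?P d (e, w)" unfolding U using ne by auto
    then show ?thesis by blast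
  qed
  then show ?thesis using up b unfolding has_dom_number_def by simp
qed

text \<open>One centre per class dominates, and a set with fewer elements than there are classes
  misses the centre of some class. The relation need not be transitive: two members of a class may
  be unrelated as long as both are related to its centre.\<close>

lemma has_dom_number_classes:
  assumes C: "finite C" "C \<noteq> {}"
    and c: "\<And>v. v \<in> V - universal_points V R \<Longrightarrow> c v \<in> C"
    and R: "\<And>u v. u \<in> V - universal_points V R \<Longrightarrow> v \<in> V - universal_points V R \<Longrightarrow>
              R u v \<Longrightarrow> c u = c v"
    and t: "\<And>s. s \<in> C \<Longrightarrow> \<exists>u \<in> V - universal_points V R. c u = s \<and>
              (\<forall>v \<in> V - universal_points V R. c v = s \<longrightarrow> R u v)"
  shows "has_dom_number V R (card C)"
proof -
  let ?X = "V - universal_points V R"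
  obtain h where h: "\<And>s. s \<in> C \<Longrightarrow> h s \<in> ?X \<and> c (h s) = s \<and> (\<forall>v\<in>?X. c v = s \<longrightarrow> R (h s) v)"
    using t by metis
  have "inj_on h C" using h by (metis inj_onI)
  then have "card (h ` C) = card C" by (rule card_image)
  moreover have "h ` C \<subseteq> ?X" using h by blast
  moreover have "\<forall>v\<in>?X. \<exists>t\<in>h ` C. R t v"
  proof
    fix v assume "v \<in> ?X"
    then show "\<exists>t\<in>h ` C. R t v" using h[of "c v"] c[of v] by blast
  qed
  moreover have "finite (h ` C)" using C by blast
  ultimately have up: "\<exists>T\<subseteq>?X. finite T \<and> card T = card C \<and> (\<forall>v\<in>?X. \<exists>t\<in>T. R t v)"
    by (intro exI[of _ "h ` C"]) simp
  have "\<exists>v\<in>?X. \<forall>d\<in>D. \<not> R d v" if D: "D \<subseteq> ?X" "finite D" "card D < card C" for D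
  proof -
    have "card (c ` D) < card C" using D by (meson card_image_le le_less_trans)
    then have "\<not> C \<subseteq> c ` D" using D(2) by (meson card_mono finite_imageI leD)
    then obtain s where s: "s \<in> C" "s \<notin> c ` D" by blast
    then have hs: "h s \<in> ?X" "c (h s) = s" using h by blast+
    have "\<not> R d (h s)" if "d \<in> D" for d
    proof
      assume "R d (h s)"
      then have "c d = s" using R[of d "h s"] hs that D(1) by auto
      then show False using s(2) that by blast
    qed
    then show ?thesis using hs by blast
  qed
  then show ?thesis using C up unfolding has_dom_number_def by (simp add: card_gt_0_iff)
qed

section \<open>Enhanced power graphs\<close>

text \<open>Adjacency in the enhanced power graph, extended reflexively.\<close>

definition cocyclic :: "('a, 'b) monoid_scheme \<Rightarrow> 'a \<Rightarrow> 'a \<Rightarrow> bool" where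
  "cocyclic G u v \<longleftrightarrow> (\<exists>w \<in> carrier G. u \<in> generate G {w} \<and> v \<in> generate G {w})"

abbreviation enhanced_dom_number :: "('a, 'b) monoid_scheme \<Rightarrow> nat \<Rightarrow> bool" where
  "enhanced_dom_number G \<equiv> has_dom_number (carrier G) (cocyclic G)"

lemma cocyclic_sym: "cocyclic G u v \<Longrightarrow> cocyclic G v u"
  unfolding cocyclic_def by blast

lemma cocyclic_refl: "u \<in> carrier G \<Longrightarrow> cocyclic G u u"
  unfolding cocyclic_def by (meson generate.incl singletonI)

lemma one_universal: "group G \<Longrightarrow> \<one>\<^bsub>G\<^esub> \<in> universal_points (carrier G) (cocyclic G)"
  unfolding universal_points_def cocyclic_def
  by (auto intro: generate.one generate.incl simp: group.is_monoid)

lemma edge_enhanced_power_graph: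
  "{u, v} \<in> edges (enhanced_power_graph G) \<longleftrightarrow>
     u \<in> carrier G \<and> v \<in> carrier G \<and> u \<noteq> v \<and> cocyclic G u v"
  unfolding enhanced_power_graph_def cocyclic_def by (auto simp: doubleton_eq_iff)

lemma dominating_vertex_iff:
  "{v. dominating_vertex (enhanced_power_graph G) v} = universal_points (carrier G) (cocyclic G)"
proof -
  have V: "vertices (enhanced_power_graph G) = carrier G"
    by (simp add: enhanced_power_graph_def)
  show ?thesis
    unfolding universal_points_def dominating_vertex_def V edge_enhanced_power_graph
    using cocyclic_sym[of G] cocyclic_refl[of _ G] by blast
qed

text \<open>Since \<open>cocyclic\<close> is reflexive, a member of \<open>D\<close> is dominated by
  itself, so the quantifier over vertices outside \<open>D\<close> may range over all remaining
  vertices.\<close>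

lemma dominating_set_proper_iff:
  "dominating_set (proper_enhanced_power_graph G) D \<longleftrightarrow>
     D \<subseteq> carrier G - universal_points (carrier G) (cocyclic G) \<and>
     (\<forall>v \<in> carrier G - universal_points (carrier G) (cocyclic G). \<exists>u \<in> D. cocyclic G u v)"
proof -
  let ?X = "carrier G - universal_points (carrier G) (cocyclic G)"
  have V: "vertices (proper_enhanced_power_graph G) = ?X"
    by (simp add: proper_enhanced_power_graph_def delete_vertices_def dominating_vertex_iff)
       (simp add: enhanced_power_graph_def)
  have E: "{u, v} \<in> edges (proper_enhanced_power_graph G) \<longleftrightarrow> u \<noteq> v \<and> cocyclic G u v"
    if "u \<in> ?X" "v \<in> ?X" for u v
    using that
    by (auto simp add: proper_enhanced_power_graph_def delete_vertices_def dominating_vertex_iff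
        edge_enhanced_power_graph)
  have "(\<forall>v\<in>?X - D. \<exists>u\<in>D. {u, v} \<in> edges (proper_enhanced_power_graph G)) \<longleftrightarrow>
        (\<forall>v\<in>?X. \<exists>u\<in>D. cocyclic G u v)" if "D \<subseteq> ?X"
  proof
    assume L: "\<forall>v\<in>?X - D. \<exists>u\<in>D. {u, v} \<in> edges (proper_enhanced_power_graph G)"
    show "\<forall>v\<in>?X. \<exists>u\<in>D. cocyclic G u v"
    proof
      fix v assume v: "v \<in> ?X"
      show "\<exists>u\<in>D. cocyclic G u v"
      proof (cases "v \<in> D")
        case True
        then show ?thesis using v cocyclic_refl[of v G] by blast
      next
        case False
        then show ?thesis using L v E[of _ v] that by blast
      qed
    qed
  next
    assume R: "\<forall>v\<in>?X. \<exists>u\<in>D. cocyclic G u v"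
    show "\<forall>v\<in>?X - D. \<exists>u\<in>D. {u, v} \<in> edges (proper_enhanced_power_graph G)"
    proof
      fix v assume v: "v \<in> ?X - D"
      then obtain u where "u \<in> D" "cocyclic G u v" using R by blast
      then show "\<exists>u\<in>D. {u, v} \<in> edges (proper_enhanced_power_graph G)"
        using v that E[of u v] by blast
    qed
  qed
  then show ?thesis unfolding dominating_set_def V by blast
qed

text \<open>The link between the graph and the relation: every later computation is done with
  \<open>enhanced_dom_number\<close>.\<close>

lemma domination_number_eqI:
  assumes "enhanced_dom_number G r"
  shows "domination_number (proper_enhanced_power_graph G) = r"
  unfolding domination_number_def dominating_set_proper_iff
proof (rule Least_equality)
  let ?X = "carrier G - universal_points (carrier G) (cocyclic G)"
  show "\<exists>D. (D \<subseteq> ?X \<and> (\<forall>v\<in>?X. \<exists>u\<in>D. cocyclic G u v)) \<and> finite D \<and> card D = r"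
    using assms unfolding has_dom_number_def by blast
  show "r \<le> d"
    if "\<exists>D. (D \<subseteq> ?X \<and> (\<forall>v\<in>?X. \<exists>u\<in>D. cocyclic G u v)) \<and> finite D \<and> card D = d" for d
    using that assms unfolding has_dom_number_def by (metis (no_types, lifting) not_le)
qed

lemma cocyclic_iso:
  assumes "group G" "group H" and f: "f \<in> iso G H"
    and uv: "u \<in> carrier G" "v \<in> carrier G"
  shows "cocyclic H (f u) (f v) \<longleftrightarrow> cocyclic G u v"
proof -
  interpret group_hom G H f
    using assms by (simp add: group_hom_def group_hom_axioms_def iso_def)
  have inj: "inj_on f (carrier G)" and im: "carrier H = f ` carrier G"
    using f by (auto simp: iso_def bij_betw_def)
  have gen: "f a \<in> generate H {f w} \<longleftrightarrow> a \<in> generate G {w}"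
    if "w \<in> carrier G" "a \<in> carrier G" for a w
  proof -
    have "generate H {f w} = f ` generate G {w}" using generate_img[of "{w}"] that by simp
    moreover have "generate G {w} \<subseteq> carrier G" using that by (intro G.generate_incl) simp
    ultimately show ?thesis using inj that by (auto dest: inj_onD)
  qed
  show ?thesis unfolding cocyclic_def im using gen uv by auto
qed

lemma enhanced_dom_number_iso:
  assumes "group G" "group H" "G \<cong> H" "enhanced_dom_number G r"
  shows "enhanced_dom_number H r"
proof -
  from assms(3) obtain f where f: "f \<in> iso G H" by (auto simp: is_iso_def)
  show ?thesis
    using f assms(4)
    by (intro has_dom_number_bij[of f "carrier G" "carrier H" "cocyclic H" "cocyclic G"])
       (auto simp: cocyclic_iso[OF assms(1,2) f] iso_def)
qed

section \<open>Direct products of groups of coprime orders\<close>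

lemma nat_pow_DirProd:
  "(a, b) [^]\<^bsub>G \<times>\<times> H\<^esub> (n :: nat) = (a [^]\<^bsub>G\<^esub> n, b [^]\<^bsub>H\<^esub> n)"
  by (induction n) (auto simp: nat_pow_def)

lemma (in group) nat_pow_cong_order:
  assumes "a \<in> carrier G" "[m = n] (mod order G)"
  shows "a [^] (m :: nat) = a [^] (n :: nat)"
proof -
  have "a [^] k = a [^] (k mod order G)" for k :: nat
  proof -
    have "a [^] k = a [^] (order G * (k div order G)) \<otimes> a [^] (k mod order G)"
      using assms by (simp add: nat_pow_mult)
    then show ?thesis using assms by (simp add: pow_order_eq_1 flip: nat_pow_pow)
  qed
  then show ?thesis using assms(2) by (metis cong_def)
qed

text \<open>The cyclic subgroup generated by \<open>(x, y)\<close> is the full product of those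
  generated by \<open>x\<close> and \<open>y\<close>. Common generators can therefore be chosen
  separately in each component.\<close>

lemma cocyclic_DirProd:
  assumes "group G" "group H" "finite (carrier G)" "finite (carrier H)"
    and co: "coprime (order G) (order H)"
    and a: "a \<in> carrier (G \<times>\<times> H)" and b: "b \<in> carrier (G \<times>\<times> H)"
  shows "cocyclic (G \<times>\<times> H) a b \<longleftrightarrow> cocyclic G (fst a) (fst b) \<and> cocyclic H (snd a) (snd b)"
proof -
  interpret G: group G by fact
  interpret H: group H by fact
  interpret P: group "G \<times>\<times> H" by (intro DirProd_group assms)
  have gG: "generate G {w} = {w [^]\<^bsub>G\<^esub> k | k. k \<in> (UNIV :: nat set)}" if "w \<in> carrier G" for w
    using that assms by (intro G.generate_pow_on_finite_carrier)
  have gH: "generate H {w} = {w [^]\<^bsub>H\<^esub> k | k. k \<in> (UNIV :: nat set)}" if "w \<in> carrier H" for w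
    using that assms by (intro H.generate_pow_on_finite_carrier)
  have gP: "generate (G \<times>\<times> H) {w} = generate G {fst w} \<times> generate H {snd w}"
    if "w \<in> carrier (G \<times>\<times> H)" for w
  proof -
    obtain x y where w: "w = (x, y)" "x \<in> carrier G" "y \<in> carrier H" using \<open>w \<in> _\<close> by auto
    have "generate (G \<times>\<times> H) {w} = {(x [^]\<^bsub>G\<^esub> k, y [^]\<^bsub>H\<^esub> k) | k. k \<in> (UNIV :: nat set)}"
      using that assms by (subst P.generate_pow_on_finite_carrier) (auto simp: w nat_pow_DirProd)
    also have "\<dots> = {x [^]\<^bsub>G\<^esub> k | k. k \<in> (UNIV :: nat set)} \<times> {y [^]\<^bsub>H\<^esub> k | k. k \<in> (UNIV :: nat set)}"
    proof -
      \<comment> \<open>The Chinese remainder theorem merges independent exponents \<open>i\<close>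
        and \<open>j\<close> into a single \<open>k\<close>, as exponents matter only modulo the
        group orders.\<close>
      have "\<exists>k :: nat. x [^]\<^bsub>G\<^esub> i = x [^]\<^bsub>G\<^esub> k \<and> y [^]\<^bsub>H\<^esub> j = y [^]\<^bsub>H\<^esub> k" for i j :: nat
      proof -
        obtain k where "[k = i] (mod order G)" "[k = j] (mod order H)"
          using binary_chinese_remainder_nat[OF co] by blast
        then show ?thesis
          using w G.nat_pow_cong_order[of x k i] H.nat_pow_cong_order[of y k j] by metis
      qed
      then show ?thesis by fastforce
    qed
    finally show ?thesis using w gG gH by simp
  qed
  have "cocyclic (G \<times>\<times> H) a b \<longleftrightarrow> (\<exists>x\<in>carrier G. \<exists>y\<in>carrier H.
      a \<in> generate G {x} \<times> generate H {y} \<and> b \<in> generate G {x} \<times> generate H {y})"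
    unfolding cocyclic_def using gP by fastforce
  then show ?thesis unfolding cocyclic_def mem_Times_iff by blast
qed

lemma enhanced_dom_number_DirProd:
  assumes "group G" "group H" "finite (carrier G)" "finite (carrier H)"
    and "coprime (order G) (order H)"
    and "enhanced_dom_number G a" "enhanced_dom_number H b"
  shows "enhanced_dom_number (G \<times>\<times> H) (min a b)"
proof -
  have "has_dom_number (carrier G \<times> carrier H)
      (\<lambda>a b. cocyclic G (fst a) (fst b) \<and> cocyclic H (snd a) (snd b)) (min a b)"
    using assms
    by (intro has_dom_number_prod[OF _ _ _ _ one_universal one_universal]) (auto intro: cocyclic_sym)
  then show ?thesis
    by (rule has_dom_number_bij[where f = id, rotated -1])
       (use assms in \<open>auto simp: cocyclic_DirProd\<close>)
qed

lemma enhanced_dom_number_cyclic_DirProd: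
  assumes "group G" "group H" "finite (carrier G)" "finite (carrier H)"
    and "coprime (order G) (order H)"
    and "cyclic_group G" "enhanced_dom_number H b"
  shows "enhanced_dom_number (G \<times>\<times> H) b"
proof -
  interpret G: group G by fact
  obtain w where "w \<in> carrier G" "carrier G = generate G {w}"
  proof -
    from \<open>cyclic_group G\<close> obtain w where w: "w \<in> carrier G" "carrier G = range (\<lambda>n::int. w [^]\<^bsub>G\<^esub> n)"
      unfolding G.cyclic_group by blast
    then have "carrier G = generate G {w}" unfolding G.generate_pow[OF w(1)] by blast
    then show ?thesis using that w(1) by blast
  qed
  then have "cocyclic G u v" if "u \<in> carrier G" "v \<in> carrier G" for u v
    using that unfolding cocyclic_def by blast
  then have "has_dom_number (carrier G \<times> carrier H)
      (\<lambda>a b. cocyclic G (fst a) (fst b) \<and> cocyclic H (snd a) (snd b)) b"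
    using assms by (intro has_dom_number_prod_total[where e = "\<one>\<^bsub>G\<^esub>"]) auto
  then show ?thesis
    by (rule has_dom_number_bij[where f = id, rotated -1])
       (use assms in \<open>auto simp: cocyclic_DirProd\<close>)
qed

text \<open>Splits off one factor, so that the result for two factors can be iterated.\<close>

lemma product_group_insert_iso:
  assumes "i \<notin> I"
  shows "product_group (insert i I) F \<cong> F i \<times>\<times> product_group I F"
proof -
  let ?f = "\<lambda>x. (x i, restrict x I)"
  have "?f \<in> hom (product_group (insert i I) F) (F i \<times>\<times> product_group I F)"
    using assms by (auto simp: hom_def PiE_iff fun_eq_iff)
  moreover have "bij_betw ?f (\<Pi>\<^sub>E j\<in>insert i I. carrier (F j)) (carrier (F i) \<times> (\<Pi>\<^sub>E j\<in>I. carrier (F j)))"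
    using assms
    by (intro bij_betwI[where g = "\<lambda>(a, x). x(i := a)"])
       (auto simp: PiE_iff extensional_def fun_eq_iff split: if_splits)
  ultimately show ?thesis unfolding is_iso_def iso_def by auto
qed

lemma order_product_group:
  assumes "finite I"
  shows "order (product_group I F) = (\<Prod>i\<in>I. order (F i))"
  using assms by (simp add: order_def card_PiE)

text \<open>The induction starts with one factor. The empty product is the trivial group, whose only
  element is universal, so it has no positive domination number.\<close>

lemma enhanced_dom_number_product_group:
  assumes "finite I" "I \<noteq> {}"
    and "\<And>i. i \<in> I \<Longrightarrow> group (F i)" "\<And>i. i \<in> I \<Longrightarrow> finite (carrier (F i))"
    and "\<And>i j. i \<in> I \<Longrightarrow> j \<in> I \<Longrightarrow> i \<noteq> j \<Longrightarrow> coprime (order (F i)) (order (F j))"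
    and "\<And>i. i \<in> I \<Longrightarrow> enhanced_dom_number (F i) (r i)"
  shows "enhanced_dom_number (product_group I F) (Min (r ` I))"
  using assms
proof (induction I rule: finite_ne_induct)
  case (singleton i)
  let ?f = "\<lambda>a. \<lambda>j\<in>{i}. a"
  have "?f \<in> iso (F i) (product_group {i} F)"
  proof -
    have "bij_betw ?f (carrier (F i)) (\<Pi>\<^sub>E j\<in>{i}. carrier (F j))"
      by (intro bij_betwI[where g = "\<lambda>x. x i"])
         (auto simp: PiE_iff extensional_def fun_eq_iff split: if_splits)
    moreover have "?f \<in> hom (F i) (product_group {i} F)"
      by (intro homI) (auto simp: fun_eq_iff)
    ultimately show ?thesis by (simp add: iso_def)
  qed
  then have "F i \<cong> product_group {i} F" unfolding is_iso_def by blast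
  moreover have "group (F i)" "group (product_group {i} F)"
    using singleton(1) by (auto intro!: product_group)
  ultimately have "enhanced_dom_number (product_group {i} F) (r i)"
    using singleton(4) by (blast intro: enhanced_dom_number_iso)
  then show ?case by simp
next
  case (insert i I)
  have grp: "group (F i)" "group (product_group (insert i I) F)" "group (product_group I F)"
    using insert.prems by (auto intro!: product_group)
  have co: "coprime (order (F i)) (order (product_group I F))"
    unfolding order_product_group[OF insert.hyps(1)]
    using insert.prems(3) insert.hyps by (intro prod_coprime_right) auto
  have fin: "finite (carrier (product_group I F))"
    using insert by (auto intro!: finite_PiE)
  have "enhanced_dom_number (product_group I F) (Min (r ` I))"
    using insert by auto
  then have "enhanced_dom_number (F i \<times>\<times> product_group I F) (min (r i) (Min (r ` I)))"
    using insert.prems grp co fin by (intro enhanced_dom_number_DirProd) auto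
  moreover have iso: "F i \<times>\<times> product_group I F \<cong> product_group (insert i I) F"
    by (rule group.iso_sym[OF grp(2) product_group_insert_iso[OF insert.hyps(3)]])
  ultimately have "enhanced_dom_number (product_group (insert i I) F) (min (r i) (Min (r ` I)))"
    using grp by (blast intro: enhanced_dom_number_iso DirProd_group)
  then show ?case using insert.hyps by simp
qed

section \<open>Odd \<open>p\<close>-groups\<close>

lemma (in group) pow_conjugate:
  assumes "y \<in> carrier G" "x \<in> carrier G"
  shows "(y \<otimes> x \<otimes> inv y) [^] (n :: nat) = y \<otimes> x [^] n \<otimes> inv y"
proof (induction n)
  case (Suc n)
  have "inv y \<otimes> (y \<otimes> (x \<otimes> inv y)) = x \<otimes> inv y"
    using assms by (metis inv_closed l_inv l_one m_assoc m_closed)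
  then show ?case using assms Suc by (simp add: m_assoc)
qed (use assms in simp)

text \<open>An exponent coprime to \<open>ord y\<close> is invertible modulo it, so \<open>y\<close>
  is itself a power of \<open>y [^] d\<close>.\<close>

lemma (in group) mem_generate_of_coprime_pow:
  assumes "y \<in> carrier G" "subgroup H G" "y [^] (d :: nat) \<in> H" "coprime d (ord y)"
  shows "y \<in> H"
proof -
  obtain e where "[d * e = 1] (mod ord y)" using cong_solve_coprime_nat[OF assms(4)] by auto
  then have "int (ord y) dvd int 1 - int (d * e)"
    by (metis cong_iff_dvd_diff cong_int_iff cong_sym)
  then have "y [^] int (d * e) = y [^] int 1"
    using assms(1) int_pow_eq by blast
  then have "(y [^] d) [^] e = y"
    using assms(1) unfolding int_pow_int by (simp add: nat_pow_pow)
  moreover have "(y [^] d) [^] e \<in> H"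
    using assms(2,3)
    by (induction e) (auto simp: subgroup.one_closed subgroup.m_closed)
  ultimately show ?thesis by simp
qed

text \<open>Two of the \<open>n\<close> elements share a coset. The indices are ordered so that,
  when \<open>f\<close> involves powers, the difference \<open>j - i\<close> is a positive exponent
  below \<open>n\<close>.\<close>

lemma (in group) coset_pigeonhole:
  assumes H: "subgroup H G" and f: "\<And>i. f i \<in> carrier G" and S: "finite S" "card S < n"
    and fS: "\<And>i. i < n \<Longrightarrow> H #> f i \<in> S"
  obtains i j :: nat where "i < j" "j < n" "f j \<otimes> inv (f i) \<in> H"
proof -
  have "card ((\<lambda>i. H #> f i) ` {..<n}) \<le> card S"
    using fS S by (intro card_mono) auto
  then have "\<not> inj_on (\<lambda>i. H #> f i) {..<n}"
    using S(2) card_image by fastforce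
  then obtain i j where ij: "i < n" "j < n" "i \<noteq> j" "H #> f i = H #> f j"
    unfolding inj_on_def by blast
  have *: "f b \<otimes> inv (f a) \<in> H" if "H #> f a = H #> f b" for a b
  proof -
    have "f b \<in> H #> f a" using that f H rcos_self by metis
    then obtain h where h: "h \<in> H" "f b = h \<otimes> f a" unfolding r_coset_def by blast
    then have "f b \<otimes> inv (f a) = h"
      using f H by (simp add: m_assoc subgroup.mem_carrier)
    then show ?thesis using h by simp
  qed
  show ?thesis
  proof (cases "i < j")
    case True
    then show ?thesis using that ij * by blast
  next
    case False
    then show ?thesis using that[of j i] ij *[of j i] by simp
  qed
qed

text \<open>An elementary count in place of the normality of subgroups of index \<open>p\<close>. It
  shows that the conjugate of some \<open>x [^] d\<close> with \<open>0 < d < p\<close> lies in the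
  subgroup; since \<open>d\<close> is coprime to \<open>p\<close>, so does the conjugate of
  \<open>x\<close>.\<close>

lemma (in group) conjugate_in_index_prime_cyclic:
  assumes fin: "finite (carrier G)" and x: "x \<in> carrier G" and y: "y \<in> carrier G"
    and p: "Factorial_Ring.prime p" and ox: "ord x = p ^ a" and oG: "order G = p * ord x"
    and yH: "y \<notin> generate G {x}"
  shows "y \<otimes> x \<otimes> inv y \<in> generate G {x}"
proof -
  define H where "H = generate G {x}"
  have H: "subgroup H G" unfolding H_def using x by (intro generate_is_subgroup) simp
  have cH: "card H = ord x" unfolding H_def using x by (simp add: generate_pow_card)
  have "ord x > 0" using ord_ge_1[OF fin x] by simp
  then have idx: "card (rcosets H) = p" using lagrange[OF H] oG cH by simp
  have xH: "x [^] i \<in> H" for i :: nat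
    unfolding H_def generate_pow_on_finite_carrier[OF fin x] by blast
  have HS: "H \<in> rcosets H" using coset_join2[OF one_closed H] rcosetsI[of H \<one>] H
    by (simp add: subgroup.one_closed subgroup.subset)
  have finR: "finite (rcosets H)" using idx p by (metis card.infinite not_prime_0)
  \<comment> \<open>No \<open>y \<otimes> x [^] i\<close> lies in \<open>H\<close>, so
    \<open>p\<close> of these elements share the \<open>p - 1\<close> cosets other than
    \<open>H\<close>.\<close>
  obtain i j where ij: "i < j" "j < p" "(y \<otimes> x [^] j) \<otimes> inv (y \<otimes> x [^] i) \<in> H"
  proof (rule coset_pigeonhole[OF H, of "\<lambda>i. y \<otimes> x [^] (i :: nat)" "rcosets H - {H}" p])
    show "y \<otimes> x [^] i \<in> carrier G" for i :: nat using x y by simp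
    show "finite (rcosets H - {H})" using finR by simp
    show "card (rcosets H - {H}) < p" using idx HS finR p by (simp add: prime_gt_0_nat)
    fix i :: nat
    have "y \<otimes> x [^] i \<notin> H"
    proof
      assume "y \<otimes> x [^] i \<in> H"
      then have "y \<otimes> x [^] i \<otimes> inv (x [^] i) \<in> H"
        using H xH by (simp add: subgroup.m_closed subgroup.m_inv_closed)
      then show False using x y yH unfolding H_def by (simp add: m_assoc)
    qed
    then have "H #> (y \<otimes> x [^] i) \<noteq> H" using x y H by (metis m_closed nat_pow_closed rcos_self)
    then show "H #> (y \<otimes> x [^] i) \<in> rcosets H - {H}"
      using x y H by (auto simp: rcosetsI subgroup.subset)
  qed blast
  define d where "d = j - i"
  have "(y \<otimes> x [^] j) \<otimes> inv (y \<otimes> x [^] i) = y \<otimes> x [^] d \<otimes> inv y"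
  proof -
    have "x [^] j = x [^] d \<otimes> x [^] i" using x ij(1) by (simp add: d_def nat_pow_mult)
    then show ?thesis using x y by (simp add: inv_mult_group m_assoc) (simp add: m_assoc[symmetric])
  qed
  then have "(y \<otimes> x \<otimes> inv y) [^] d \<in> H" using ij(3) pow_conjugate[OF y x] by simp
  moreover have "coprime d (ord (y \<otimes> x \<otimes> inv y))"
  proof -
    have "\<not> p dvd d" using ij by (auto simp: d_def dest!: dvd_imp_le)
    then have "coprime d (ord x)"
      unfolding ox using p by (metis coprime_commute coprime_power_right_iff prime_imp_coprime)
    moreover have "ord (y \<otimes> x \<otimes> inv y) dvd ord x"
      using x y pow_conjugate[OF y x, of "ord x"] by (simp flip: pow_eq_id)
    ultimately show ?thesis by (meson coprime_divisors dvd_refl)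
  qed
  ultimately show ?thesis
    using mem_generate_of_coprime_pow[of "y \<otimes> x \<otimes> inv y" H d] x y H unfolding H_def by simp
qed

text \<open>The \<open>p + 1\<close> powers from \<open>y [^] 0\<close> to \<open>y [^] p\<close>
  meet only \<open>p\<close> cosets, so \<open>y [^] d\<close> lies in \<open>H\<close> for some
  \<open>d\<close> between \<open>1\<close> and \<open>p\<close>. A \<open>d\<close> below
  \<open>p\<close> would be coprime to \<open>ord y\<close> and would put \<open>y\<close> into
  \<open>H\<close>.\<close>

lemma (in group) pow_in_index_prime:
  assumes fin: "finite (carrier G)" and H: "subgroup H G" and y: "y \<in> carrier G" "y \<notin> H"
    and p: "Factorial_Ring.prime p" and oG: "order G = p ^ b" and oH: "order G = p * card H"
  shows "y [^] p \<in> H"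
proof -
  have "order G > 0" using fin by (simp add: order_gt_0_iff_finite)
  then have idx: "card (rcosets H) = p" using lagrange[OF H] oH by simp
  have finR: "finite (rcosets H)" using idx p by (metis card.infinite not_prime_0)
  obtain i j where ij: "i < j" "j < Suc p" "y [^] j \<otimes> inv (y [^] i) \<in> H"
    by (rule coset_pigeonhole[OF H, of "\<lambda>i. y [^] (i :: nat)" "rcosets H" "Suc p"])
       (use y finR idx H in \<open>auto simp: rcosetsI subgroup.subset\<close>)
  define d where "d = j - i"
  have "y [^] j = y [^] d \<otimes> y [^] i" using y ij(1) by (simp add: d_def nat_pow_mult)
  then have yd: "y [^] d \<in> H" using ij(3) y by (simp add: m_assoc)
  have "d = p"
  proof (rule ccontr)
    assume "d \<noteq> p"
    then have "\<not> p dvd d" using ij by (auto simp: d_def dest!: dvd_imp_le)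
    moreover obtain c where "ord y = p ^ c"
      using ord_dvd_group_order[OF y(1)] oG p divides_primepow_nat by metis
    ultimately have "coprime d (ord y)"
      using p by (metis coprime_commute coprime_power_right_iff prime_imp_coprime)
    then show False using mem_generate_of_coprime_pow[OF y(1) H yd] y(2) by simp
  qed
  then show ?thesis using yd by simp
qed

section \<open>Twisted commutation and a geometric sum\<close>

text \<open>Moving one \<open>y\<close> to the right past a power of \<open>x\<close> multiplies its
  exponent by \<open>s\<close>, which produces geometric sums. Both the odd \<open>p\<close>-groups
  and the quaternion groups use these formulas.\<close>

lemma (in group) pow_mult_twisted:
  assumes x: "x \<in> carrier G" and y: "y \<in> carrier G"
    and s: "y \<otimes> x \<otimes> inv y = x [^] (s :: nat)"
  shows "y [^] (m :: nat) \<otimes> x [^] (n :: nat) = x [^] (s ^ m * n) \<otimes> y [^] m"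
    and "(x [^] (i :: nat) \<otimes> y) [^] (m :: nat) = x [^] (i * (\<Sum>l<m. s ^ l)) \<otimes> y [^] m"
proof -
  have yx: "y \<otimes> x [^] n = x [^] (s * n) \<otimes> y" for n :: nat
  proof -
    have "x [^] (s * n) \<otimes> y = (y \<otimes> x [^] n \<otimes> inv y) \<otimes> y"
      using pow_conjugate[OF y x, of n] x s by (simp add: nat_pow_pow)
    then show ?thesis using x y by (simp add: m_assoc)
  qed
  show *: "y [^] m \<otimes> x [^] n = x [^] (s ^ m * n) \<otimes> y [^] m" for m n :: nat
  proof (induction m arbitrary: n)
    case (Suc m)
    have "y [^] Suc m \<otimes> x [^] n = y [^] m \<otimes> (y \<otimes> x [^] n)"
      using x y by (simp add: m_assoc)
    also have "\<dots> = (y [^] m \<otimes> x [^] (s * n)) \<otimes> y" using yx x y by (simp add: m_assoc)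
    also have "\<dots> = x [^] (s ^ m * (s * n)) \<otimes> y [^] Suc m" using x y Suc by (simp add: m_assoc)
    finally show ?case by (simp add: mult_ac)
  qed (use x in simp)
  show "(x [^] i \<otimes> y) [^] m = x [^] (i * (\<Sum>l<m. s ^ l)) \<otimes> y [^] m"
  proof (induction m)
    case (Suc m)
    have "(x [^] i \<otimes> y) [^] Suc m = x [^] (i * (\<Sum>l<m. s ^ l)) \<otimes> (y [^] m \<otimes> x [^] i) \<otimes> y"
      using x y Suc by (simp add: m_assoc)
    also have "\<dots> = (x [^] (i * (\<Sum>l<m. s ^ l)) \<otimes> x [^] (s ^ m * i)) \<otimes> y [^] Suc m"
      unfolding * using x y by (simp add: m_assoc)
    also have "\<dots> = x [^] (i * (\<Sum>l<m. s ^ l) + s ^ m * i) \<otimes> y [^] Suc m"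
      using x by (simp add: nat_pow_mult)
    finally show ?case by (simp add: algebra_simps)
  qed (use x y in simp)
qed

text \<open>By Fermat \<open>s\<close> is 1 modulo \<open>p\<close>, say \<open>s = 1 + p c\<close>,
  so \<open>s ^ l\<close> is \<open>1 + l p c\<close> modulo the square of \<open>p\<close>. The
  linear terms add up to \<open>p c\<close> times \<open>p (p - 1) / 2\<close>, which vanishes
  modulo that square because \<open>p\<close> is odd. For \<open>p = 2\<close> and
  \<open>s = 3\<close> the sum is 4, so oddness matters.\<close>

lemma geometric_sum_prime:
  fixes p s :: nat
  assumes p: "Factorial_Ring.prime p" "odd p" and s: "[s ^ p = 1] (mod p)"
  obtains t where "(\<Sum>l<p. s ^ l) = p * t" "coprime t p"
proof -
  have sp: "[s ^ p = s] (mod p)"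
  proof (cases "p dvd s")
    case True
    then show ?thesis using p by (simp add: cong_def dvd_power_le prime_gt_0_nat mod_eq_0_iff_dvd[THEN iffD2] prime_dvd_power_iff)
  next
    case False
    then have "[s ^ (p - 1) * s = 1 * s] (mod p)" using p fermat_theorem by (intro cong_scalar_right) auto
    then show ?thesis using p by (metis mult_1 power_minus_mult prime_gt_0_nat)
  qed
  then have "[int s = 1] (mod int p)" using s by (metis cong_int_iff cong_sym cong_trans of_nat_1)
  then obtain c where c: "int s = 1 + int p * c" by (metis cong_iff_lin cong_sym)
  have pw: "[int s ^ l = 1 + int l * int p * c] (mod (int p)\<^sup>2)" for l
  proof (induction l)
    case (Suc l)
    have "[int s ^ Suc l = (1 + int p * c) * (1 + int l * int p * c)] (mod (int p)\<^sup>2)"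
      using Suc c by (simp add: cong_scalar_left)
    moreover have "(1 + int p * c) * (1 + int l * int p * c)
        = 1 + int (Suc l) * int p * c + (int p)\<^sup>2 * (int l * c * c)"
      by (simp add: algebra_simps power2_eq_square)
    ultimately show ?case by (simp add: cong_def)
  qed simp
  have "[(\<Sum>l<p. int s ^ l) = (\<Sum>l<p. 1 + int l * int p * c)] (mod (int p)\<^sup>2)"
    using pw by (intro cong_sum) auto
  moreover have "(\<Sum>l<p. 1 + int l * int p * c) = int p + (\<Sum>l<p. int l) * int p * c"
    by (simp add: sum.distrib sum_distrib_right)
  \<comment> \<open>Oddness enters here: \<open>q\<close> is \<open>(p - 1) / 2\<close>.\<close>
  moreover obtain q where q: "p = 2 * q + 1" using p(2) by (metis oddE)
  have "(\<Sum>l<2 * k + 1. int l) = (2 * int k + 1) * int k" for k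
    by (induction k) (auto simp: algebra_simps)
  then have "(\<Sum>l<p. int l) = int p * int q" unfolding q by simp
  with calculation have "[(\<Sum>l<p. int s ^ l) = int p + (int p)\<^sup>2 * (int q * c)] (mod (int p)\<^sup>2)"
    by (simp add: power2_eq_square mult_ac)
  then have "[(\<Sum>l<p. int s ^ l) = int p] (mod (int p)\<^sup>2)" by (simp add: cong_def)
  then obtain e where "int p = (\<Sum>l<p. int s ^ l) + (int p)\<^sup>2 * e" by (metis cong_iff_lin)
  then have e: "int (\<Sum>l<p. s ^ l) = int p * (1 - int p * e)"
    by (simp add: algebra_simps power2_eq_square)
  then have "int p dvd int (\<Sum>l<p. s ^ l)" by (metis dvd_triv_left)
  then obtain t where t: "(\<Sum>l<p. s ^ l) = p * t" by (metis dvdE int_dvd_int_iff)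
  then have "int t = 1 - int p * e" using e p by (simp add: prime_gt_0_nat)
  have "\<not> p dvd t"
  proof
    assume "p dvd t"
    then have "int p dvd int t + int p * e" by simp
    then show False using \<open>int t = 1 - int p * e\<close> p(1) by (simp add: prime_nat_iff)
  qed
  then have "coprime t p" using p by (simp add: coprime_commute prime_imp_coprime)
  then show ?thesis using that t by blast
qed


section \<open>Groups with a single subgroup of odd prime order\<close>

lemma (in group) prime_order_imp_generate:
  assumes "Factorial_Ring.prime (order G)"
  shows "\<exists>x \<in> carrier G. carrier G = generate G {x}"
proof -
  have fin: "finite (carrier G)"
    using assms by (metis card.infinite not_prime_0 order_def)
  have "carrier G \<noteq> {\<one>}" using assms by (metis card_1_singleton_iff not_prime_1 order_def One_nat_def)
  then obtain y where y: "y \<in> carrier G" "y \<noteq> \<one>" using one_closed by blast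
  have "ord y = order G"
    using ord_dvd_group_order[OF y(1)] assms ord_eq_1[OF y(1)] y(2) by (metis prime_nat_iff)
  then have "card (generate G {y}) = card (carrier G)"
    using y generate_pow_card by (simp add: order_def)
  then have "generate G {y} = carrier G"
    using fin y generate_incl[of "{y}"] by (intro card_subset_eq) auto
  then show ?thesis using y by blast
qed

lemma (in group) generate_pow_singleton:
  assumes "finite (carrier G)" "x \<in> carrier G"
  shows "generate G {x} = range (\<lambda>n :: nat. x [^] n)"
  using generate_pow_on_finite_carrier[OF assms] by auto

text \<open>An element \<open>y\<close> outside \<open>H = \<langle>x\<rangle>\<close> satisfies \<open>y\<^sup>p \<in> H\<close>. If \<open>y\<^sup>p\<close> generates \<open>H\<close>, then \<open>y\<close> generates
  \<open>G\<close>. Otherwise \<open>y\<^sup>p\<close> is a \<open>p\<close>-th power in \<open>H\<close>, and since \<open>p\<close> is odd, \<open>i\<close> can be chosen so that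
  \<open>(x\<^sup>i y)\<^sup>p = 1\<close>, which gives a second subgroup of order \<open>p\<close>.\<close>

lemma (in group) generate_of_cyclic_index_prime:
  assumes p: "Factorial_Ring.prime p" "odd p" and fin: "finite (carrier G)"
    and oG: "order G = p ^ Suc a" and a: "a \<noteq> 0"
    and H: "subgroup H G" "card H = p ^ a" and x: "x \<in> H" "H = generate G {x}"
    and uniq: "\<And>H K. subgroup H G \<Longrightarrow> card H = p \<Longrightarrow> subgroup K G \<Longrightarrow> card K = p \<Longrightarrow> H = K"
  shows "\<exists>x \<in> carrier G. carrier G = generate G {x}"
proof -
  have xG: "x \<in> carrier G" using x H by (simp add: subgroup.mem_carrier)
  have ox: "ord x = p ^ a" using H(2) x xG generate_pow_card by simp
  have "card H < card (carrier G)"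
    using H oG prime_gt_1_nat[OF p(1)] by (simp add: order_def)
  then obtain y where y: "y \<in> carrier G" "y \<notin> H"
    using H(1) fin by (metis card_mono finite_subset leD subgroup.subset subsetI)
  have xH: "x [^] i \<in> H" for i :: nat
    using x(2) generate_pow_singleton[OF fin xG] by auto
  have "y \<otimes> x \<otimes> inv y \<in> H"
    unfolding x(2) using conjugate_in_index_prime_cyclic[OF fin xG y(1) p(1) ox] oG ox y(2) x(2)
    by simp
  then obtain s :: nat where s: "y \<otimes> x \<otimes> inv y = x [^] s"
    unfolding x(2) generate_pow_singleton[OF fin xG] by blast
  have "y [^] p \<in> H"
    using pow_in_index_prime[OF fin H(1) y p(1) oG] oG H(2) by simp
  then obtain t :: nat where t: "y [^] p = x [^] t"
    unfolding x(2) generate_pow_singleton[OF fin xG] by blast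
  show ?thesis
  proof (cases "p dvd t")
    case False
    then have "coprime t (ord x)"
      unfolding ox using p by (metis coprime_commute coprime_power_right_iff prime_imp_coprime)
    moreover have Y: "subgroup (generate G {y}) G" using y by (intro generate_is_subgroup) simp
    moreover have yY: "y [^] k \<in> generate G {y}" for k :: nat
      using generate_pow_singleton[OF fin y(1)] by auto
    ultimately have "x \<in> generate G {y}"
      using mem_generate_of_coprime_pow[OF xG Y, of t] t by metis
    then have "H \<subseteq> generate G {y}" unfolding x(2) using Y by (intro generate_subgroup_incl) auto
    moreover have "y \<in> generate G {y}" by (simp add: generate.incl)
    moreover have fY: "finite (generate G {y})" using Y fin by (meson finite_subset subgroup.subset)
    ultimately have "card H < card (generate G {y})" using y(2) by (metis psubsetI psubset_card_mono)
    then have "p ^ a < ord y" using H(2) y(1) generate_pow_card by simp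
    \<comment> \<open>The order of \<open>y\<close> is a power of \<open>p\<close> that exceeds
      \<open>p ^ a\<close> and divides \<open>p ^ Suc a\<close>.\<close>
    moreover obtain b where b: "ord y = p ^ b" "b \<le> Suc a"
      using ord_dvd_group_order[OF y(1)] oG p(1) divides_primepow_nat by metis
    ultimately have "\<not> b \<le> a" using p(1) by (metis leD power_increasing prime_ge_1_nat)
    then have "b = Suc a" using b(2) by simp
    then have "card (generate G {y}) = card (carrier G)"
      using b(1) oG generate_pow_card[OF y(1)] by (simp add: order_def)
    then have "generate G {y} = carrier G"
      using fin Y by (intro card_subset_eq) (auto simp: subgroup.subset)
    then show ?thesis using y(1) by blast
  next
    case True
    then obtain j where j: "t = p * j" by (elim dvdE)
    \<comment> \<open>As a power of \<open>x\<close>, the element \<open>y [^] p\<close> commutes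
      with \<open>x\<close>. Comparison with the twisted commutation gives
      \<open>x = x [^] (s ^ p)\<close>.\<close>
    have "y [^] p \<otimes> x [^] (1::nat) = x [^] (s ^ p * 1) \<otimes> y [^] p"
      by (rule pow_mult_twisted(1)[OF xG y(1) s])
    then have "x [^] t \<otimes> x = x [^] (s ^ p) \<otimes> x [^] t" using t xG by simp
    also have "\<dots> = x [^] t \<otimes> x [^] (s ^ p)" using xG by (simp add: nat_pow_mult add.commute)
    finally have "x = x [^] (s ^ p)" using xG by (metis l_cancel nat_pow_closed)
    then have "x [^] int 1 = x [^] int (s ^ p)" using xG by (simp only: int_pow_int) simp
    then have "int (ord x) dvd int (s ^ p) - int 1" using int_pow_eq xG by blast
    then have "[s ^ p = 1] (mod p ^ a)" by (metis cong_iff_dvd_diff cong_int_iff ox)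
    then have "[s ^ p = 1] (mod p)" by (rule cong_dvd_modulus_nat) (use a in simp)
    then obtain u where u: "(\<Sum>l<p. s ^ l) = p * u" "coprime u p"
      using geometric_sum_prime p by blast
    have "coprime u (p ^ a)" using u(2) by simp
    then obtain e where e: "[u * e = 1] (mod p ^ a)"
      using cong_solve_coprime_nat[of u "p ^ a"] by auto
    \<comment> \<open>Chosen to solve \<open>i * u + j = 0\<close> modulo \<open>p ^ a\<close>:
      \<open>e\<close> inverts \<open>u\<close>, and \<open>p ^ a - 1\<close> stands for
      \<open>-1\<close> among the natural numbers. Multiplying by \<open>p\<close> then kills the
      exponent of \<open>(x [^] i \<otimes> y) [^] p\<close>.\<close>
    define i where "i = e * (p ^ a - 1) * j"
    have "[u * e * ((p ^ a - 1) * j) + j = 1 * ((p ^ a - 1) * j) + j] (mod p ^ a)"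
      using e by (intro cong_add cong_mult) auto
    moreover have "1 * ((p ^ a - 1) * j) + j = p ^ a * j"
    proof -
      have "p ^ a > 0" using p by (simp add: prime_gt_0_nat)
      then show ?thesis by (cases "p ^ a") auto
    qed
    ultimately have "p ^ a dvd i * u + j"
      by (simp add: i_def cong_def mult_ac mod_eq_0_iff_dvd)
    then have dvd: "ord x dvd i * (p * u) + p * j" unfolding ox
      by (metis distrib_left dvd_mult mult.left_commute)
    define w where "w = x [^] i \<otimes> y"
    have wG: "w \<in> carrier G" using xG y by (simp add: w_def)
    have "w [^] p = x [^] (i * (p * u)) \<otimes> x [^] (p * j)"
      unfolding w_def pow_mult_twisted(2)[OF xG y(1) s] u(1) t j ..
    also have "\<dots> = \<one>" using dvd xG by (simp add: nat_pow_mult pow_eq_id)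
    finally have "ord w dvd p" using pow_eq_id[OF wG] by blast
    moreover have wH: "w \<notin> H"
    proof
      assume "w \<in> H"
      then have "inv (x [^] i) \<otimes> w \<in> H" using xH H(1) by (simp add: subgroup.m_closed subgroup.m_inv_closed)
      moreover have "inv (x [^] i) \<otimes> w = y" unfolding w_def using xG y by (simp add: m_assoc[symmetric])
      ultimately show False using y by simp
    qed
    then have "ord w \<noteq> 1" using ord_eq_1[OF wG] H(1) subgroup.one_closed by auto
    ultimately have ow: "ord w = p" using p(1) by (auto simp: prime_nat_iff)
    \<comment> \<open>An element of order \<open>p\<close> inside \<open>H\<close>. Uniqueness would
      identify its subgroup with that of \<open>w\<close>, although \<open>w\<close> lies outside
      \<open>H\<close>.\<close>
    define z where "z = x [^] (p ^ (a - 1))"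
    have zG: "z \<in> carrier G" using xG by (simp add: z_def)
    have "ord z = p ^ a div p ^ (a - 1)"
      unfolding z_def using ord_pow[OF xG] ox p by (simp add: le_imp_power_dvd prime_gt_0_nat)
    then have oz: "ord z = p" using a p by (simp add: power_diff[symmetric] prime_gt_0_nat)
    have "generate G {w} = generate G {z}"
      using ow oz wG zG by (intro uniq generate_is_subgroup) (auto simp: generate_pow_card[symmetric])
    moreover have "generate G {z} \<subseteq> H" using xH H(1) unfolding z_def by (intro generate_subgroup_incl) auto
    ultimately show ?thesis using wH generate.incl[of w "{w}" G] by auto
  qed
qed

text \<open>Induction on the exponent: a subgroup of index \<open>p\<close> inherits uniqueness,
  hence is cyclic, and the index \<open>p\<close> step lifts this to the whole group. Order
  \<open>p\<close> is treated directly because the subgroup would be trivial.\<close>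

lemma unique_subgroup_of_odd_prime_order_imp_cyclic:
  assumes p: "Factorial_Ring.prime p" "odd p"
    and "group G" "order G = p ^ a"
    and "\<And>H K. subgroup H G \<Longrightarrow> card H = p \<Longrightarrow> subgroup K G \<Longrightarrow> card K = p \<Longrightarrow> H = K"
  shows "\<exists>x \<in> carrier G. carrier G = generate G {x}"
  using assms(3-)
proof (induction a arbitrary: G)
  case 0
  interpret group G by fact
  have "card (carrier G) = 1" using 0 by (simp add: order_def)
  then have "carrier G = {\<one>\<^bsub>G\<^esub>}" using one_closed by (metis card_1_singletonE singletonD)
  then show ?case by (metis generate_one singletonI)
next
  case (Suc a)
  interpret group G by fact
  show ?case
  proof (cases "a = 0")
    case True
    then show ?thesis using Suc.prems p prime_order_imp_generate by simp
  next
    case False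
    have fin: "finite (carrier G)"
      using Suc.prems p by (metis card.infinite not_prime_0 order_def power_not_zero)
    \<comment> \<open>Sylow existence is applied to \<open>p ^ a\<close>, which is not the full
      power of \<open>p\<close> in the order; this yields index \<open>p\<close>.\<close>
    obtain H where H: "subgroup H G" "card H = p ^ a"
      using sylow_thm[of p G a p] p fin Suc.prems by auto
    have "\<exists>x \<in> carrier (G\<lparr>carrier := H\<rparr>). carrier (G\<lparr>carrier := H\<rparr>) = generate (G\<lparr>carrier := H\<rparr>) {x}"
    proof (rule Suc.IH)
      show "group (G\<lparr>carrier := H\<rparr>)" using H by (simp add: subgroup_imp_group)
      show "order (G\<lparr>carrier := H\<rparr>) = p ^ a" using H by (simp add: order_def)
      show "A = B" if "subgroup A (G\<lparr>carrier := H\<rparr>)" "card A = p"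
          "subgroup B (G\<lparr>carrier := H\<rparr>)" "card B = p" for A B
        using that Suc.prems(3) incl_subgroup[OF H(1)] by blast
    qed
    then obtain x where "x \<in> H" "H = generate G {x}"
      using generate_consistent[OF _ H(1)] by auto
    then show ?thesis
      using generate_of_cyclic_index_prime[OF p fin Suc.prems(2) False H _ _ Suc.prems(3)] by blast
  qed
qed

section \<open>Domination numbers of noncyclic odd \<open>p\<close>-groups\<close>

text \<open>If \<open>w [^] k\<close> has trivial \<open>p\<close>-th power, then \<open>k\<close>
  is a multiple of \<open>ord w div p\<close>. The explicit generator shows that the subgroup is
  determined by \<open>w\<close>.\<close>

lemma (in group) subgroup_prime_order_in_cyclic:
  assumes fin: "finite (carrier G)" and w: "w \<in> carrier G" and p: "Factorial_Ring.prime p"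
    and H: "subgroup H G" "card H = p" "H \<subseteq> generate G {w}"
  shows "p dvd ord w" "H = generate G {w [^] (ord w div p)}"
proof -
  have ow: "ord w > 0" using ord_ge_1[OF fin w] by simp
  have W: "subgroup (generate G {w}) G" using w by (intro generate_is_subgroup) simp
  have "subgroup H (G\<lparr>carrier := generate G {w}\<rparr>)" using H W by (simp add: subgroup_incl)
  moreover have "group (G\<lparr>carrier := generate G {w}\<rparr>)" using W by (simp add: subgroup_imp_group)
  ultimately show dvd: "p dvd ord w"
    using group.lagrange[of "G\<lparr>carrier := generate G {w}\<rparr>" H] H(2) generate_pow_card[OF w]
    by (metis dvd_triv_right order_def partial_object.simps(1) partial_object.surjective partial_object.update_convs(1))
  let ?z = "w [^] (ord w div p)"
  have z: "?z \<in> carrier G" using w by simp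
  obtain q where q: "ord w = p * q" using dvd by (elim dvdE)
  then have oz: "ord ?z = p"
    using ord_pow[OF w, of q] ow p by (simp add: prime_gt_0_nat)
  have "h \<in> generate G {?z}" if h: "h \<in> H" for h
  proof -
    obtain k :: nat where k: "h = w [^] k" using h H(3) generate_pow_singleton[OF fin w] by auto
    have "h [^] p = \<one>"
    proof -
      have g: "group (G\<lparr>carrier := H\<rparr>)" using H by (simp add: subgroup_imp_group)
      have "h [^]\<^bsub>G\<lparr>carrier := H\<rparr>\<^esub> order (G\<lparr>carrier := H\<rparr>) = \<one>"
        using group.pow_order_eq_1[OF g] h by simp
      then show ?thesis using H(2) by (simp add: order_def nat_pow_consistent[symmetric])
    qed
    then have "ord w dvd k * p" using k w by (simp add: nat_pow_pow pow_eq_id)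
    then have "ord w div p dvd k" using dvd p by (metis div_dvd_iff_mult not_prime_0)
    then obtain q where "k = (ord w div p) * q" by (elim dvdE)
    then have "h = ?z [^] q" using k w by (simp add: nat_pow_pow)
    then show ?thesis using generate_pow_singleton[OF fin z] by auto
  qed
  then show "H = generate G {?z}"
    using oz H(2) z fin generate_incl[of "{?z}"] generate_pow_card[OF z]
    by (intro card_subset_eq) (auto intro: finite_subset)
qed

lemma enhanced_dom_number_p_group:
  fixes G (structure)
  assumes p: "Factorial_Ring.prime p" "odd p" and "group G" and oG: "order G = p ^ a"
    and nc: "\<not> cyclic_group G"
  shows "enhanced_dom_number G (num_subgroups G p)"
proof -
  interpret group G by fact
  have fin: "finite (carrier G)"
    using oG p by (metis card.infinite not_prime_0 order_def power_not_zero)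
  let ?C = "{H. subgroup H G \<and> card H = p}"
  let ?U = "universal_points (carrier G) (cocyclic G)"
  \<comment> \<open>For \<open>v \<noteq> \<one>\<close> this is the subgroup of order
    \<open>p\<close> below \<open>v\<close>, the class of \<open>v\<close>. At the identity it is
    only the trivial subgroup, so \<open>c\<close> is used away from it.\<close>
  define c where "c v = generate G {v [^] (ord v div p)}" for v
  have "\<not> (\<exists>x \<in> carrier G. carrier G = generate G {x})"
    using nc cyclic_group generate_pow by fastforce
  then obtain H K where HK: "H \<in> ?C" "K \<in> ?C" "H \<noteq> K"
    using unique_subgroup_of_odd_prime_order_imp_cyclic[OF p \<open>group G\<close> oG] by blast
  have finC: "finite ?C"
    by (rule finite_subset[of _ "Pow (carrier G)"]) (auto simp: fin dest: subgroup.subset)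
  have ordp: "p dvd ord v" if v: "v \<in> carrier G" "v \<noteq> \<one>" for v
  proof -
    obtain b where "ord v = p ^ b" using ord_dvd_group_order[OF v(1)] oG p divides_primepow_nat by metis
    then show ?thesis using ord_eq_1[OF v(1)] v(2) by (cases b) auto
  qed
  have cC: "c v \<in> ?C" "c v \<subseteq> generate G {v}" if v: "v \<in> carrier G" "v \<noteq> \<one>" for v
  proof -
    have z: "v [^] (ord v div p) \<in> carrier G" using v by simp
    have o: "ord v > 0" using ord_ge_1[OF fin v(1)] by simp
    obtain q where q: "ord v = p * q" using ordp[OF v] by (elim dvdE)
    have "ord (v [^] (ord v div p)) = p"
      using ord_pow[OF v(1), of q] q o p by (simp add: prime_gt_0_nat)
    then show "c v \<in> ?C" using generate_is_subgroup z generate_pow_card[OF z] by (simp add: c_def)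
    show "c v \<subseteq> generate G {v}"
      unfolding c_def using v generate_pow_singleton[OF fin v(1)]
      by (intro generate_subgroup_incl generate_is_subgroup) auto
  qed
  have sub: "c u = c w" if w: "w \<in> carrier G" "u \<in> generate G {w}" "u \<noteq> \<one>" for u w
  proof -
    have W: "subgroup (generate G {w}) G" using w by (intro generate_is_subgroup) simp
    have u: "u \<in> carrier G" using W w(2) by (rule subgroup.mem_carrier)
    have "generate G {u} \<subseteq> generate G {w}" using W w(2) by (intro generate_subgroup_incl) auto
    then have "c u \<subseteq> generate G {w}" using cC(2)[OF u w(3)] by blast
    then show ?thesis
      using subgroup_prime_order_in_cyclic(2)[OF fin w(1) p(1)] cC(1)[OF u w(3)] by (simp add: c_def)
  qed
  have cR: "c u = c v" if "cocyclic G u v" "u \<noteq> \<one>" "v \<noteq> \<one>" for u v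
    using that sub unfolding cocyclic_def by metis
  have gen: "\<exists>h \<in> carrier G. h \<noteq> \<one> \<and> c h = H \<and> (\<forall>v \<in> carrier G - {\<one>}. c v = H \<longrightarrow> cocyclic G h v)"
    if H: "H \<in> ?C" for H
  proof -
    have "card H > 1" using H prime_gt_1_nat[OF p(1)] by simp
    then have "H \<noteq> {\<one>}" by auto
    then obtain h where h: "h \<in> H" "h \<noteq> \<one>" using H subgroup.one_closed by blast
    have hG: "h \<in> carrier G" using H h by (auto intro: subgroup.mem_carrier)
    have "c h \<subseteq> H"
      using cC(2)[OF hG h(2)] generate_subgroup_incl[of "{h}" H] H h by blast
    then have "c h = H" using cC(1)[OF hG h(2)] H fin
      by (intro card_subset_eq) (auto intro: finite_subset dest: subgroup.subset)
    \<comment> \<open>Here \<open>h\<close> lies in \<open>c v\<close>, hence in the subgroup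
      generated by \<open>v\<close>, so \<open>v\<close> is a common generator.\<close>
    moreover have "cocyclic G h v" if "v \<in> carrier G - {\<one>}" "c v = H" for v
      using that h cC(2)[of v] generate.incl[of v "{v}" G] unfolding cocyclic_def by blast
    ultimately show ?thesis using hG h by blast
  qed
  have U: "?U = {\<one>}"
  proof
    show "{\<one>} \<subseteq> ?U" using one_universal[OF \<open>group G\<close>] by simp
    show "?U \<subseteq> {\<one>}"
    proof (rule subsetI, rule ccontr)
      fix v assume v: "v \<in> ?U" "v \<notin> {\<one>}"
      \<comment> \<open>Two subgroups of order \<open>p\<close> exist, so some class differs from
        that of \<open>v\<close>, and its centre is not cocyclic with \<open>v\<close>.\<close>
      obtain L where L: "L \<in> ?C" "L \<noteq> c v" using HK by blast
      then obtain h where "h \<in> carrier G" "h \<noteq> \<one>" "c h = L" using gen by blast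
      then show False using v L cR[of v h] unfolding universal_points_def by auto
    qed
  qed
  have "has_dom_number (carrier G) (cocyclic G) (card ?C)"
  proof (rule has_dom_number_classes[where c = c], unfold U)
    show "finite ?C" "?C \<noteq> {}" using finC HK by auto
    show "c v \<in> ?C" if "v \<in> carrier G - {\<one>}" for v using cC(1) that by simp
    show "c u = c v" if "u \<in> carrier G - {\<one>}" "v \<in> carrier G - {\<one>}" "cocyclic G u v" for u v
      using cR that by simp
    show "\<exists>u\<in>carrier G - {\<one>}. c u = s \<and> (\<forall>v\<in>carrier G - {\<one>}. c v = s \<longrightarrow> cocyclic G u v)"
      if "s \<in> ?C" for s using gen[OF that] by blast
  qed
  then show ?thesis by (simp add: num_subgroups_def)
qed

section \<open>Generalized quaternion groups\<close>

text \<open>Apart from finiteness, these facts are all that the graph is computed from. The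
  complement is counted as twice \<open>2 ^ (k - 2)\<close> because it will be split into
  pairs.\<close>

lemma generalized_quaternion_structure:
  fixes Q (structure)
  assumes k: "k \<ge> 3" and Q: "generalized_quaternion k Q"
  obtains x z where "x \<in> carrier Q" "z \<in> generate Q {x}" "x \<noteq> \<one>" "x \<noteq> z" "z \<noteq> \<one>" "z \<otimes> z = \<one>"
    "card (carrier Q - generate Q {x}) = 2 * 2 ^ (k - 2)"
    "\<And>w. w \<in> carrier Q \<Longrightarrow> w \<notin> generate Q {x} \<Longrightarrow> w \<otimes> w = z"
proof -
  interpret group Q using Q by (simp add: generalized_quaternion_def)
  define M :: nat where "M = 2 ^ (k - 2)"
  have M2: "M \<ge> 2" using k power_increasing[of 1 "k - 2" "2::nat"] by (simp add: M_def)
  have k1: "2 ^ (k - 1) = 2 * M" "2 ^ k = 4 * M"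
  proof -
    have "k - 1 = Suc (k - 2)" "k = Suc (Suc (k - 2))" using k by auto
    then show "2 ^ (k - 1) = 2 * M" "2 ^ k = 4 * M"
      unfolding M_def by (metis power_Suc, metis power_Suc mult.assoc mult_2 numeral_Bit0)
  qed
  have oQ: "order Q = 4 * M" using Q k1 by (simp add: generalized_quaternion_def)
  then have fin: "finite (carrier Q)" using M2 order_gt_0_iff_finite by simp
  obtain x y where xy: "x \<in> carrier Q" "y \<in> carrier Q" and gen: "generate Q {x, y} = carrier Q"
    and xN: "x [^] (2 * M) = \<one>" and xM: "x [^] M = y [^] (2 :: nat)" and conj: "y \<otimes> x \<otimes> inv y = inv x"
    using Q k1 unfolding generalized_quaternion_def M_def by metis
  \<comment> \<open>The natural exponent that represents inversion of \<open>x\<close>, so that the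
    twisted power formulas apply.\<close>
  define s where "s = 2 * M - 1"
  have inv_pow: "inv g = g [^] (n - 1)" if "g \<in> carrier Q" "g [^] n = \<one>" "n > 0" for g and n :: nat
  proof (rule inv_equality)
    have "g [^] (n - 1) \<otimes> g = g [^] n"
      using that(3) nat_pow_Suc[of g "n - 1"] by simp
    then show "g [^] (n - 1) \<otimes> g = \<one>" using that(2) by simp
  qed (use that in auto)
  have s: "y \<otimes> x \<otimes> inv y = x [^] s"
    using conj inv_pow[OF xy(1) xN] M2 by (simp add: s_def)
  note tw = pow_mult_twisted[OF xy s]
  \<comment> \<open>Since \<open>y [^] 2\<close> is a power of \<open>x\<close>, only the parity of
    the exponent of \<open>y\<close> survives.\<close>
  have yred: "\<exists>i. y [^] m = x [^] (i :: nat) \<otimes> y [^] (m mod 2)" for m :: nat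
  proof -
    have "y [^] m = (y [^] (2::nat)) [^] (m div 2) \<otimes> y [^] (m mod 2)"
      using xy by (simp add: nat_pow_pow nat_pow_mult)
    then show ?thesis using xy by (auto simp: nat_pow_pow simp flip: xM)
  qed
  have repr: "\<exists>i m. g = x [^] (i :: nat) \<otimes> y [^] (m :: nat)" if "g \<in> carrier Q" for g
  proof -
    have "g \<in> generate Q {x, y}" using that gen by simp
    then show ?thesis
    proof induction
      case one
      then show ?case by (auto intro!: exI[of _ 0])
    next
      case (incl h)
      then show ?case
      proof
        assume "h = x"
        then have "h = x [^] (1::nat) \<otimes> y [^] (0::nat)" using xy by simp
        then show ?thesis by blast
      next
        assume "h \<in> {y}"
        then have "h = x [^] (0::nat) \<otimes> y [^] (1::nat)" using xy by simp
        then show ?thesis by blast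
      qed
    next
      case (inv h)
      then show ?case
      proof
        assume "h = x"
        then have "inv h = x [^] s \<otimes> y [^] (0::nat)" using s conj xy by simp
        then show ?thesis by blast
      next
        assume "h \<in> {y}"
        then have "inv h = x [^] (0::nat) \<otimes> y [^] (order Q - 1)"
          using inv_pow[OF xy(2) pow_order_eq_1[OF xy(2)]] xy oQ M2 by simp
        then show ?thesis by blast
      qed
    next
      case (eng h1 h2)
      then obtain i m j l :: nat where h: "h1 = x [^] i \<otimes> y [^] m" "h2 = x [^] j \<otimes> y [^] l" by blast
      have "h1 \<otimes> h2 = x [^] i \<otimes> (y [^] m \<otimes> x [^] j) \<otimes> y [^] l"
        using h xy by (simp add: m_assoc)
      also have "\<dots> = (x [^] i \<otimes> x [^] (s ^ m * j)) \<otimes> (y [^] m \<otimes> y [^] l)"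
        unfolding tw(1) using xy by (simp add: m_assoc)
      also have "\<dots> = x [^] (i + s ^ m * j) \<otimes> y [^] (m + l)" using xy by (simp add: nat_pow_mult)
      finally show ?case by blast
    qed
  qed
  define H where "H = generate Q {x}"
  have H: "subgroup H Q" unfolding H_def using xy by (intro generate_is_subgroup) simp
  have Hp: "H = range (\<lambda>n :: nat. x [^] n)" unfolding H_def by (rule generate_pow_singleton[OF fin xy(1)])
  have out: "\<exists>i :: nat. w = x [^] i \<otimes> y" if w: "w \<in> carrier Q" "w \<notin> H" for w
  proof -
    obtain i m :: nat where im: "w = x [^] i \<otimes> y [^] m" using repr[OF w(1)] by blast
    obtain j :: nat where "y [^] m = x [^] j \<otimes> y [^] (m mod 2)" using yred by blast
    then have wx: "w = x [^] (i + j) \<otimes> y [^] (m mod 2)"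
      using im xy by (simp add: m_assoc[symmetric] nat_pow_mult)
    moreover have "m mod 2 = 1"
    proof (rule ccontr)
      assume "m mod 2 \<noteq> 1"
      then have "w = x [^] (i + j)" using wx xy by (metis mod2_eq_if nat_pow_0 nat_pow_closed r_one)
      then show False using w(2) Hp by blast
    qed
    ultimately show ?thesis using xy by auto
  qed
  have cH: "card H = ord x" unfolding H_def using xy generate_pow_card by simp
  have fH: "finite H" using H fin by (meson finite_subset subgroup.subset)
  have "ord x dvd 2 * M" using xN xy pow_eq_id by blast
  then have ole: "ord x \<le> 2 * M" using M2 by (intro dvd_imp_le) auto
  \<comment> \<open>The relations give only that \<open>ord x\<close> divides \<open>2 * M\<close>.
    The complement of \<open>H\<close> lies in one coset of \<open>H\<close>, so \<open>H\<close>
    contains at least half of the group, and equality follows.\<close>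
  have "carrier Q - H \<subseteq> (\<lambda>h. h \<otimes> y) ` H" using out Hp by fast
  then have "card (carrier Q - H) \<le> ord x"
    using fH cH by (metis card_image_le card_mono finite_imageI le_trans)
  moreover have cd: "card (carrier Q - H) = 4 * M - ord x"
    using cH oQ fH H by (simp add: card_Diff_subset order_def subgroup.subset)
  ultimately have ox: "ord x = 2 * M" using ole by simp
  have xpow: "x [^] n = \<one> \<longleftrightarrow> 2 * M dvd n" for n :: nat using pow_eq_id[OF xy(1)] ox by simp
  show ?thesis
  proof (rule that[of x "x [^] M"])
    show "x \<in> carrier Q" by fact
    show "x [^] M \<in> generate Q {x}" using Hp H_def by blast
    show "x \<noteq> \<one>" using xpow[of 1] xy M2 by auto
    show "x [^] M \<noteq> \<one>" using xpow[of M] M2 by (auto dest: dvd_imp_le)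
    show "x \<noteq> x [^] M"
    proof
      assume "x = x [^] M"
      moreover have "x [^] M = x [^] (M - 1) \<otimes> x" using M2 nat_pow_Suc[of x "M - 1"] by simp
      ultimately have "x [^] (M - 1) = \<one>" using xy r_cancel[of "x [^] (M - 1)" x \<one>] by auto
      then show False using xpow M2 by (auto dest: dvd_imp_le)
    qed
    show "x [^] M \<otimes> x [^] M = \<one>" using xy xN by (simp add: nat_pow_mult mult_2)
    show "card (carrier Q - generate Q {x}) = 2 * 2 ^ (k - 2)"
      using cd ox by (simp add: H_def M_def)
    show "w \<otimes> w = x [^] M" if w: "w \<in> carrier Q" "w \<notin> generate Q {x}" for w
    proof -
      obtain i :: nat where i: "w = x [^] i \<otimes> y" using out w by (auto simp: H_def)
      have "w \<otimes> w = w [^] (2 :: nat)" using w by (simp add: numeral_2_eq_2)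
      also have "\<dots> = x [^] (i * (\<Sum>l<2. s ^ l)) \<otimes> y [^] (2 :: nat)" unfolding i by (rule tw(2))
      \<comment> \<open>The sum is \<open>1 + s\<close>, so the \<open>x\<close> part of the square
        vanishes and only \<open>y [^] 2\<close> remains.\<close>
      also have "(\<Sum>l<2. s ^ l) = 2 * M" using M2 by (simp add: s_def numeral_2_eq_2)
      also have "x [^] (i * (2 * M)) = \<one>" using xpow by simp
      finally show ?thesis using xM xy by simp
    qed
  qed
qed

lemma enhanced_dom_number_quaternion:
  fixes Q (structure)
  assumes k: "k \<ge> 3" and Q: "generalized_quaternion k Q"
  shows "enhanced_dom_number Q (2 ^ (k - 2) + 1)"
proof -
  interpret group Q using Q by (simp add: generalized_quaternion_def)
  have fin: "finite (carrier Q)"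
    using Q order_gt_0_iff_finite by (simp add: generalized_quaternion_def)
  obtain x z where x: "x \<in> carrier Q" and z: "z \<in> generate Q {x}" "x \<noteq> \<one>" "x \<noteq> z" "z \<noteq> \<one>" "z \<otimes> z = \<one>"
    and cd: "card (carrier Q - generate Q {x}) = 2 * 2 ^ (k - 2)"
    and sq: "\<And>w. w \<in> carrier Q \<Longrightarrow> w \<notin> generate Q {x} \<Longrightarrow> w \<otimes> w = z"
    using generalized_quaternion_structure[OF k Q] by metis
  define H where "H = generate Q {x}"
  have H: "subgroup H Q" unfolding H_def using x by (intro generate_is_subgroup) simp
  have xH: "x \<in> H" by (simp add: H_def generate.incl)
  have zH: "z \<in> H" using z by (simp add: H_def)
  then have zQ: "z \<in> carrier Q" using H by (simp add: subgroup.mem_carrier)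
  have zz: "z \<otimes> (z \<otimes> w) = w" if "w \<in> carrier Q" for w
    using that z zQ by (simp add: m_assoc[symmetric])
  have zout: "z \<otimes> w \<notin> H" if "w \<in> carrier Q" "w \<notin> H" for w
  proof
    assume "z \<otimes> w \<in> H"
    then have "z \<otimes> (z \<otimes> w) \<in> H" using zH H by (simp add: subgroup.m_closed)
    then show False using that zz by simp
  qed
  have zne: "z \<otimes> w \<noteq> w" if "w \<in> carrier Q" for w
    using that z(4) zQ r_cancel[of z w \<one>] by auto
  \<comment> \<open>Outside \<open>H\<close> every element has order 4, with \<open>z\<close> as its
    square.\<close>
  have gen: "generate Q {w} = {\<one>, z, w, z \<otimes> w}" if w: "w \<in> carrier Q" "w \<notin> H" for w
  proof
    have ww: "w \<otimes> w = z" using sq w by (simp add: H_def)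
    have "w [^] n \<in> {\<one>, z, w, z \<otimes> w}" for n :: nat
    proof (induction n)
      case (Suc n)
      have "z \<otimes> w \<otimes> w = \<one>" using ww w z zQ by (simp add: m_assoc)
      then show ?case using Suc w ww by auto
    qed simp
    then show "generate Q {w} \<subseteq> {\<one>, z, w, z \<otimes> w}"
      using generate_pow_singleton[OF fin w(1)] by auto
    have W: "w \<in> generate Q {w}" by (simp add: generate.incl)
    have "z \<in> generate Q {w}" using generate.eng[OF W W] ww by simp
    then show "{\<one>, z, w, z \<otimes> w} \<subseteq> generate Q {w}"
      using W generate.eng[of z Q "{w}" w] by (auto intro: generate.one)
  qed
  have genH: "generate Q {w} \<subseteq> H" if "w \<in> H" for w
    using that H by (intro generate_subgroup_incl) auto
  let ?U = "universal_points (carrier Q) (cocyclic Q)"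
  have coH: "cocyclic Q u v" if "u \<in> H" "v \<in> H" for u v
    using that x unfolding cocyclic_def H_def by blast
  have coz: "cocyclic Q z u" if u: "u \<in> carrier Q" for u
  proof (cases "u \<in> H")
    case True
    then show ?thesis using coH zH by simp
  next
    case False
    then show ?thesis using u gen unfolding cocyclic_def by blast
  qed
  \<comment> \<open>A common generator must lie outside \<open>H\<close>, and the cyclic subgroup it
    generates meets \<open>H\<close> only in \<open>{\<one>, z}\<close>.\<close>
  have sep: "\<not> cocyclic Q u v" if "u \<in> H - {\<one>, z}" "v \<in> carrier Q - H" for u v
  proof
    assume "cocyclic Q u v"
    then obtain w where w: "w \<in> carrier Q" "u \<in> generate Q {w}" "v \<in> generate Q {w}"
      unfolding cocyclic_def by blast
    then have "w \<notin> H" using genH that by blast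
    then show False using w(1,2) gen zout that(1) by auto
  qed
  have "carrier Q - H \<noteq> {}" using cd unfolding H_def by (metis card.empty mult_is_0 power_not_zero zero_neq_numeral)
  then obtain y where y: "y \<in> carrier Q - H" by blast
  have U: "?U = {\<one>, z}"
  proof
    show "{\<one>, z} \<subseteq> ?U"
      using one_universal[OF is_group] coz zQ by (auto simp: universal_points_def)
    show "?U \<subseteq> {\<one>, z}"
    proof (rule subsetI, rule ccontr)
      fix u assume u: "u \<in> ?U" "u \<notin> {\<one>, z}"
      then have uQ: "u \<in> carrier Q" and co: "cocyclic Q u v" if "v \<in> carrier Q" for v
        using that by (auto simp: universal_points_def)
      show False
      proof (cases "u \<in> H")
        case True
        then show False using sep[of u y] co[of y] u y by auto
      next
        case False
        then show False using sep[of x u] cocyclic_sym[OF co[of x]] uQ x xH z by auto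
      qed
    qed
  qed
  define c where "c u = (if u \<in> H then H else {u, z \<otimes> u})" for u
  let ?P = "(\<lambda>u. {u, z \<otimes> u}) ` (carrier Q - H)"
  have fP: "finite ?P" using fin by simp
  \<comment> \<open>Multiplication by \<open>z\<close> is a fixed-point-free involution on the
    complement of \<open>H\<close>, so the pairs partition it.\<close>
  have "2 * card ?P = card (\<Union>?P)"
  proof (rule card_partition)
    show "finite ?P" by fact
    show "finite (\<Union>?P)" using fin by auto
    show "card A = 2" if "A \<in> ?P" for A using that zne by force
    show "A \<inter> B = {}" if AB: "A \<in> ?P" "B \<in> ?P" "A \<noteq> B" for A B
    proof -
      obtain a b where ab: "A = {a, z \<otimes> a}" "B = {b, z \<otimes> b}" "a \<in> carrier Q" "b \<in> carrier Q"
        using AB(1,2) by blast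
      show ?thesis
      proof (rule ccontr)
        assume "A \<inter> B \<noteq> {}"
        then consider "b = a" | "b = z \<otimes> a" | "a = z \<otimes> b" | "z \<otimes> a = z \<otimes> b"
          unfolding ab(1,2) by blast
        then have "b = a \<or> b = z \<otimes> a" using zz[OF ab(3)] zz[OF ab(4)] by cases metis+
        then show False using AB(3) zz[OF ab(3)] unfolding ab(1,2) by (metis insert_commute)
      qed
    qed
  qed
  also have "\<Union>?P = carrier Q - H" using zout zQ by auto
  finally have cP: "card ?P = 2 ^ (k - 2)" using cd by (simp add: H_def)
  have "H \<notin> ?P" by auto
  then have cC: "card (insert H ?P) = 2 ^ (k - 2) + 1" using fP cP by simp
  have "has_dom_number (carrier Q) (cocyclic Q) (card (insert H ?P))"
  proof (rule has_dom_number_classes[where c = c], unfold U)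
    show "finite (insert H ?P)" "insert H ?P \<noteq> {}" using fP by auto
    show "c v \<in> insert H ?P" if "v \<in> carrier Q - {\<one>, z}" for v
      using that by (auto simp: c_def)
    show "c u = c v" if uv: "u \<in> carrier Q - {\<one>, z}" "v \<in> carrier Q - {\<one>, z}" "cocyclic Q u v" for u v
    proof -
      obtain w where w: "w \<in> carrier Q" "u \<in> generate Q {w}" "v \<in> generate Q {w}"
        using uv(3) unfolding cocyclic_def by blast
      show ?thesis
      proof (cases "w \<in> H")
        case True
        then show ?thesis using genH w by (auto simp: c_def)
      next
        case False
        then have "g = w \<or> g = z \<otimes> w" if "g \<in> generate Q {w}" "g \<notin> {\<one>, z}" for g
          using that gen w(1) by auto
        then have "c g = {w, z \<otimes> w}" if "g \<in> generate Q {w}" "g \<notin> {\<one>, z}" for g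
          using that False zout[OF w(1) False] zz[OF w(1)] unfolding c_def by (metis insert_commute)
        then show ?thesis using w uv by simp
      qed
    qed
    show "\<exists>u\<in>carrier Q - {\<one>, z}. c u = A \<and> (\<forall>v\<in>carrier Q - {\<one>, z}. c v = A \<longrightarrow> cocyclic Q u v)"
      if A: "A \<in> insert H ?P" for A
      using A
    proof
      assume AH: "A = H"
      \<comment> \<open>A pair \<open>{v, z \<otimes> v}\<close> with \<open>v\<close> outside
        \<open>H\<close> cannot equal \<open>H\<close>. The centre of this class is
        \<open>x\<close>, which is neither \<open>\<one>\<close> nor \<open>z\<close>.\<close>
      have "v \<in> H" if "c v = H" for v using that by (auto simp: c_def split: if_splits)
      then show ?thesis using AH coH xH x z by (intro bexI[of _ x]) (auto simp: c_def)
    next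
      assume "A \<in> ?P"
      then obtain u where u: "u \<in> carrier Q" "u \<notin> H" "A = {u, z \<otimes> u}" by auto
      have "cocyclic Q u v" if "v \<in> carrier Q" "c v = A" for v
      proof -
        have "v \<in> A" using that u by (auto simp: c_def split: if_splits)
        then show ?thesis using gen[OF u(1,2)] u unfolding cocyclic_def by blast
      qed
      moreover have "u \<notin> {\<one>, z}" using u zH H subgroup.one_closed by auto
      ultimately show ?thesis using u by (intro bexI[of _ u]) (auto simp: c_def)
    qed
  qed
  then show ?thesis using cC by simp
qed

section \<open>Products of noncyclic Sylow subgroups\<close>

text \<open>Injectivity of \<open>p\<close> makes the Sylow orders pairwise coprime, and each
  \<open>p i\<close> divides the odd group order, hence is odd. The factors are thus covered by the
  result on noncyclic odd \<open>p\<close>-groups.\<close>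

lemma enhanced_dom_number_noncyclic_sylows:
  fixes G1 :: "('b, 'c) monoid_scheme" and m :: nat
  assumes G1: "group G1" "finite (carrier G1)" "odd (order G1)" and m: "m \<ge> 1"
    and p: "bij_betw p {1..m} (prime_factors (order G1))"
    and P: "\<And>i. i \<in> {1..m} \<Longrightarrow> sylow_subgroup G1 (p i) (P i) \<and> \<not> cyclic_group (G1\<lparr>carrier := P i\<rparr>)"
    and iso: "G1 \<cong> product_group {1..m} (\<lambda>i. G1\<lparr>carrier := P i\<rparr>)"
  shows "enhanced_dom_number G1
    (Min ((\<lambda>i. num_subgroups (G1\<lparr>carrier := P i\<rparr>) (p i)) ` {1..m}))"
proof -
  interpret group G1 by fact
  let ?F = "\<lambda>i. G1\<lparr>carrier := P i\<rparr>"
  have sub: "subgroup (P i) G1" and ord: "order (?F i) = p i ^ multiplicity (p i) (order G1)"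
    and pp: "Factorial_Ring.prime (p i)" if "i \<in> {1..m}" for i
    using P[OF that] by (auto simp: sylow_subgroup_def order_def)
  have po: "odd (p i)" if "i \<in> {1..m}" for i
  proof -
    have "p i \<in> prime_factors (order G1)" using p that by (auto simp: bij_betw_def)
    then have "p i dvd order G1" by (simp add: in_prime_factors_iff)
    then show ?thesis using G1(3) by (meson dvd_trans)
  qed
  have grp: "group (?F i)" if "i \<in> {1..m}" for i
    using sub[OF that] by (simp add: subgroup_imp_group)
  have "enhanced_dom_number (product_group {1..m} ?F)
      (Min ((\<lambda>i. num_subgroups (?F i) (p i)) ` {1..m}))"
  proof (rule enhanced_dom_number_product_group)
    show "{1..m} \<noteq> {}" using m by simp
    show "finite (carrier (?F i))" if "i \<in> {1..m}" for i
      using sub[OF that] G1(2) by (auto intro: finite_subset dest: subgroup.subset)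
    show "coprime (order (?F i)) (order (?F j))" if ij: "i \<in> {1..m}" "j \<in> {1..m}" "i \<noteq> j" for i j
    proof -
      have "p i \<noteq> p j" using p ij by (auto simp: bij_betw_def dest: inj_onD)
      then have "coprime (p i) (p j)" using pp ij by (simp add: primes_coprime)
      then show ?thesis unfolding ord[OF ij(1)] ord[OF ij(2)] by simp
    qed
    show "enhanced_dom_number (?F i) (num_subgroups (?F i) (p i))" if "i \<in> {1..m}" for i
      using enhanced_dom_number_p_group[OF pp po grp ord] P that by blast
  qed (use grp in auto)
  moreover have "product_group {1..m} ?F \<cong> G1" using iso by (rule iso_sym)
  moreover have "group (product_group {1..m} ?F)" using grp by (intro product_group) auto
  ultimately show ?thesis using G1(1) by (blast intro: enhanced_dom_number_iso)
qed

lemma domination_number_isoI: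
  assumes "group G" "group K" "G \<cong> K" "enhanced_dom_number K d"
  shows "domination_number (proper_enhanced_power_graph G) = d"
  using assms by (meson domination_number_eqI enhanced_dom_number_iso group.iso_sym)

theorem theorem2p5:
  fixes k n m :: nat
    and G :: "('a, 'a1) monoid_scheme"
    and Q :: "('q, 'q1) monoid_scheme"
    and G1 :: "('b, 'b1) monoid_scheme"
    and p :: "nat \<Rightarrow> nat"
    and P :: "nat \<Rightarrow> 'b set"
    and r :: "nat \<Rightarrow> nat"
  assumes "k \<ge> 3"
    and "n > 0" and "odd n"
    and "generalized_quaternion k Q"
    and "group G"
  shows "(G \<cong> Q \<or> G \<cong> integer_mod_group n \<times>\<times> Q \<longrightarrow>
            domination_number (proper_enhanced_power_graph G) = 2 ^ (k - 2) + 1)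
       \<and> (group G1 \<and> finite (carrier G1) \<and> odd (order G1) \<and> nilpotent_group G1 \<and>
          m \<ge> 1 \<and> bij_betw p {1..m} (prime_factors (order G1)) \<and>
          (\<forall>i\<in>{1..m}. sylow_subgroup G1 (p i) (P i) \<and> \<not> cyclic_group (G1\<lparr>carrier := P i\<rparr>)) \<and>
          G1 \<cong> product_group {1..m} (\<lambda>i. G1\<lparr>carrier := P i\<rparr>) \<and>
          (\<forall>i\<in>{1..m}. r i = num_subgroups (G1\<lparr>carrier := P i\<rparr>) (p i)) \<and>
          (\<forall>i\<in>{1..m}. \<forall>j\<in>{1..m}. i \<le> j \<longrightarrow> r i \<le> r j) \<and>
          (G \<cong> G1 \<times>\<times> Q \<or>
           coprime (order G1) n \<and> G \<cong> G1 \<times>\<times> integer_mod_group n \<times>\<times> Q) \<longrightarrow>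
            domination_number (proper_enhanced_power_graph G) = min (r 1) (2 ^ (k - 2) + 1))"
proof (intro conjI impI)
  have Q: "group Q" "order Q = 2 ^ k" using assms(4) by (auto simp: generalized_quaternion_def)
  then have finQ: "finite (carrier Q)" by (metis card.infinite order_def power_not_zero zero_neq_numeral)
  have edQ: "enhanced_dom_number Q (2 ^ (k - 2) + 1)"
    using assms(1,4) by (rule enhanced_dom_number_quaternion)
  let ?Z = "integer_mod_group n"
  have finZ: "finite (carrier ?Z)" and oZ: "order ?Z = n"
    using assms(2) by (auto simp: carrier_integer_mod_group order_def)
  \<comment> \<open>The generator is written \<open>1 mod int n\<close> to cover
    \<open>n = 1\<close>, where it is 0.\<close>
  have cycZ: "cyclic_group ?Z"
  proof -
    have "carrier ?Z = range (\<lambda>i::int. (1 mod int n) [^]\<^bsub>?Z\<^esub> i)"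
    proof
      show "carrier ?Z \<subseteq> range (\<lambda>i::int. (1 mod int n) [^]\<^bsub>?Z\<^esub> i)"
        using assms(2) by (auto simp: carrier_integer_mod_group int_pow_integer_mod_group
            mod_mult_right_eq image_iff) (metis mod_pos_pos_trivial)
    qed (use assms(2) in \<open>auto simp: carrier_integer_mod_group int_pow_integer_mod_group\<close>)
    moreover have "1 mod int n \<in> carrier ?Z" using assms(2) by (simp add: carrier_integer_mod_group)
    ultimately show ?thesis unfolding group.cyclic_group[OF group_integer_mod_group] by blast
  qed
  have grpZQ: "group (?Z \<times>\<times> Q)" using Q by (simp add: DirProd_group)
  have edZQ: "enhanced_dom_number (?Z \<times>\<times> Q) (2 ^ (k - 2) + 1)"
    using Q finQ finZ oZ cycZ edQ assms(3) by (intro enhanced_dom_number_cyclic_DirProd) auto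
  show "domination_number (proper_enhanced_power_graph G) = 2 ^ (k - 2) + 1"
    if "G \<cong> Q \<or> G \<cong> ?Z \<times>\<times> Q"
    using that domination_number_isoI[OF assms(5) Q(1) _ edQ]
      domination_number_isoI[OF assms(5) grpZQ _ edZQ] by blast
  assume G1: "group G1 \<and> finite (carrier G1) \<and> odd (order G1) \<and> nilpotent_group G1 \<and>
      m \<ge> 1 \<and> bij_betw p {1..m} (prime_factors (order G1)) \<and>
      (\<forall>i\<in>{1..m}. sylow_subgroup G1 (p i) (P i) \<and> \<not> cyclic_group (G1\<lparr>carrier := P i\<rparr>)) \<and>
      G1 \<cong> product_group {1..m} (\<lambda>i. G1\<lparr>carrier := P i\<rparr>) \<and>
      (\<forall>i\<in>{1..m}. r i = num_subgroups (G1\<lparr>carrier := P i\<rparr>) (p i)) \<and>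
      (\<forall>i\<in>{1..m}. \<forall>j\<in>{1..m}. i \<le> j \<longrightarrow> r i \<le> r j) \<and>
      (G \<cong> G1 \<times>\<times> Q \<or> coprime (order G1) n \<and> G \<cong> G1 \<times>\<times> ?Z \<times>\<times> Q)"
  have "(\<lambda>i. num_subgroups (G1\<lparr>carrier := P i\<rparr>) (p i)) ` {1..m} = r ` {1..m}"
    using G1 by (intro image_cong) auto
  then have "enhanced_dom_number G1 (Min (r ` {1..m}))"
    using enhanced_dom_number_noncyclic_sylows[of G1 m p P] G1 by simp
  \<comment> \<open>The indexing by increasing \<open>r\<close> puts the minimum at index 1.\<close>
  moreover have "Min (r ` {1..m}) = r 1" using G1 by (intro Min_eqI) auto
  ultimately have ed1: "enhanced_dom_number G1 (r 1)" by simp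
  have ed1Q: "enhanced_dom_number (G1 \<times>\<times> Q) (min (r 1) (2 ^ (k - 2) + 1))"
    using G1 Q finQ edQ ed1 by (intro enhanced_dom_number_DirProd) auto
  \<comment> \<open>The product nests to the right, so the second factor is
    \<open>?Z \<times>\<times> Q\<close> of order \<open>n * 2 ^ k\<close>. It is coprime to
    \<open>order G1\<close>, which is odd and coprime to \<open>n\<close>.\<close>
  have ed1ZQ: "enhanced_dom_number (G1 \<times>\<times> ?Z \<times>\<times> Q) (min (r 1) (2 ^ (k - 2) + 1))"
    if "coprime (order G1) n"
    using G1 Q finQ finZ oZ edZQ ed1 grpZQ that
    by (intro enhanced_dom_number_DirProd) (auto simp: order_def card_cartesian_product)
  have grp: "group (G1 \<times>\<times> Q)" "group (G1 \<times>\<times> ?Z \<times>\<times> Q)"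
    using G1 Q(1) grpZQ by (auto intro: DirProd_group)
  show "domination_number (proper_enhanced_power_graph G) = min (r 1) (2 ^ (k - 2) + 1)"
    using G1 domination_number_isoI[OF assms(5) grp(1) _ ed1Q]
      domination_number_isoI[OF assms(5) grp(2) _ ed1ZQ] by blast
qed

end
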